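(* Let $R$ be a finite non-local commutative ring with non-zero identity. Then the Jacobson graph $\mathfrak{J}_R$ is Hamiltonian, except when $R\cong\mathbb{Z}_2\oplus F$ for some finite field $F$, in which case $\mathfrak{J}_R$ is not Hamiltonian but has a Hamiltonian path.
   Context: All rings are commutative with a non-zero identity. For a ring $R$, $J(R)$ denotes its Jacobson radical and $U(R)$ its group of units. The Jacobson graph $\mathfrak{J}_R$ of $R$ is the simple graph with vertex set $R\setminus J(R)$ in which two distinct vertices $x,y$ are adjacent if and only if $1-xy\notin U(R)$. $\mathbb{Z}_m$ denotes the ring $\mathbb{Z}/m\mathbb{Z}$ and $\oplus$ is the direct sum (product) of rings. A Hamiltonian cycle (resp. path) in a graph is a cycle (of length at least 3) (resp. path) including all the vertices of the graph; a graph is Hamiltonian if it has a Hamiltonian cycle. *)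

theory Defs
  imports
    "HOL-Algebra.Chinese_Remainder"
    "HOL-Number_Theory.Residues"
    "Graph_Theory.Pair_Digraph"
begin

section \<open>Rings\<close>

definition local_ring :: "('a, 'm) ring_scheme \<Rightarrow> bool" where
  "local_ring R \<longleftrightarrow> cring R \<and> (\<exists>!M. maximalideal M R)"

definition jacobson_radical :: "('a, 'm) ring_scheme \<Rightarrow> 'a set" where
  "jacobson_radical R = carrier R \<inter> \<Inter>{M. maximalideal M R}"

text \<open>
  \<open>R\<close> is isomorphic to the direct sum of the integers modulo 2 and the finite field \<open>F\<close>.
  HOL cannot quantify over the type of \<open>F\<close>. When \<open>R\<close> has element type \<open>'a\<close> and some such \<open>F\<close>
  exists at all, one exists over \<open>'a\<close>, namely the ideal of \<open>R\<close> corresponding to the second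
  summand. So nothing is lost by taking \<open>F :: 'a ring\<close> when asserting that there is no such \<open>F\<close>.
\<close>

definition Z2_plus_finite_field :: "('a, 'm) ring_scheme \<Rightarrow> ('b, 'n) ring_scheme \<Rightarrow> bool" where
  "Z2_plus_finite_field R F \<longleftrightarrow>
     field F \<and> finite (carrier F) \<and> R \<simeq> RDirProd (residue_ring 2) F"


section \<open>The Jacobson graph\<close>

text \<open>An undirected edge is represented by its two opposite arcs.\<close>

definition jacobson_graph :: "('a, 'm) ring_scheme \<Rightarrow> 'a pair_pre_digraph" where
  "jacobson_graph R =
     \<lparr> pverts = carrier R - jacobson_radical R,
       parcs = {(x, y). x \<in> carrier R - jacobson_radical R \<and> y \<in> carrier R - jacobson_radical R \<and>
                        x \<noteq> y \<and> \<one>\<^bsub>R\<^esub> \<ominus>\<^bsub>R\<^esub> x \<otimes>\<^bsub>R\<^esub> y \<notin> Units R} \<rparr>"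

lemma pair_graph_jacobson_graph:
  assumes "cring R" and "finite (carrier R)"
  shows "pair_graph (jacobson_graph R)"
proof -
  interpret cring R by fact
  let ?V = "carrier R - jacobson_radical R"
  have "parcs (jacobson_graph R) \<subseteq> ?V \<times> ?V"
    by (auto simp: jacobson_graph_def)
  then have "finite (parcs (jacobson_graph R))"
    by (rule finite_subset) (use assms(2) in auto)
  then show ?thesis
    using assms(2)
    by unfold_locales
      (auto simp: jacobson_graph_def m_comm symmetric_def intro!: symI)
qed


section \<open>Hamiltonian cycles and paths\<close>

text \<open>
  A cycle is the list of its arcs, so the vertices it passes through are the tails of these arcs.
  The bound on the length excludes walking an edge back and forth.
\<close>

definition hamiltonian_cycle :: "'a pair_pre_digraph \<Rightarrow> ('a \<times> 'a) awalk \<Rightarrow> bool" where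
  "hamiltonian_cycle G p \<longleftrightarrow>
     pre_digraph.cycle (with_proj G) p \<and> 3 \<le> length p \<and> fst ` set p = pverts G"

definition hamiltonian :: "'a pair_pre_digraph \<Rightarrow> bool" where
  "hamiltonian G \<longleftrightarrow> (\<exists>p. hamiltonian_cycle G p)"

definition has_hamiltonian_path :: "'a pair_pre_digraph \<Rightarrow> bool" where
  "has_hamiltonian_path G \<longleftrightarrow>
     (\<exists>u p v. pre_digraph.apath (with_proj G) u p v \<and>
              set (pre_digraph.awalk_verts (with_proj G) u p) = pverts G)"

end

theory Submission
  imports Defs
begin

text \<open>
  Modulo the Jacobson radical \<open>J\<close> the ring is finite and reduced, so \<open>x\<close> has a generalized inverse
  \<open>x'\<close>, a power of \<open>x\<close>, with \<open>x x'\<close> idempotent and nonzero unless \<open>x = 0\<close>. If the reduced ring is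
  a product, then two tuples are adjacent as soon as some coordinates are \<open>x \<noteq> 0\<close> and \<open>x'\<close>, and
  this is all that the constructions of cycles use. The vertices whose first coordinate is 1 form
  a clique \<open>K\<close>. Hence it suffices to partition the vertices into paths with both ends in \<open>K\<close>.
  Such partitions exist for a product of three nontrivial rings and for a product of two fields
  other than \<open>\<int>\<^sub>2\<close>. Each Hamiltonian cycle of the reduced ring lifts to the original ring by going
  around it \<open>card J\<close> times. For \<open>\<int>\<^sub>2 \<oplus> F\<close> and \<open>card J \<ge> 2\<close> the copies of a vertex provide the
  missing connections, whereas for \<open>card J = 1\<close> the vertex \<open>(0, 1)\<close> has degree 1.
\<close>

section \<open>Hamiltonian paths and cycles of relations\<close>

text \<open>A nonzero g with g (x y) = g annihilates 1 - x y, which is why a coordinate x facing x'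
  makes two tuples adjacent. The decomposition of the reduced ring stops at two or three factors:
  non-locality supplies one idempotent e other than 0 and 1, and either e or 1 - e splits once more,
  or both corners are fields. The constructions only see finite sets with an involution x to x' and
  two distinguished fixed points 0 and 1. Two kinds of vertices are obstacles. A tuple whose only
  nonzero coordinate is w is sure to be adjacent only to tuples with w' in that place, so it has to
  be inserted between two of them. A self-inverse coordinate has no partner to alternate with; in a
  field the only one besides 0 and 1 can be -1. In the factor \<int>_2 nothing but 0 and 1 is left,
  so the vertices with second coordinate 1 are just (0, 1) and (1, 1), and the first of them has no
  way out.\<close>

definition hpath :: "('v \<Rightarrow> 'v \<Rightarrow> bool) \<Rightarrow> 'v set \<Rightarrow> 'v \<Rightarrow> 'v \<Rightarrow> bool" where
  "hpath E W u v \<longleftrightarrow>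
     (\<exists>xs. xs \<noteq> [] \<and> hd xs = u \<and> last xs = v \<and> distinct xs \<and> set xs = W \<and> successively E xs)"

text \<open>The relation may have loops, and a single loop or an edge walked back and forth counts as a
  cycle here. The bound on the length enters only in the translation to graphs.\<close>

definition hcycle :: "('v \<Rightarrow> 'v \<Rightarrow> bool) \<Rightarrow> 'v set \<Rightarrow> bool" where
  "hcycle E W \<longleftrightarrow> (\<exists>u v. hpath E W u v \<and> E v u)"

lemma hpath_single: "hpath E {u} u u"
  unfolding hpath_def by (rule exI[of _ "[u]"]) auto

text \<open>For u = v this is a single vertex with a loop. A segment from an element to its inverse
  thus stays a path when the element is self-inverse.\<close>

lemma hpath_edge: "E u v \<Longrightarrow> hpath E {u, v} u v"
  unfolding hpath_def
  by (cases "u = v", rule exI[of _ "[u]"], simp, rule exI[of _ "[u, v]"], simp)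

lemma hpath_append:
  assumes "hpath E W u v" and "hpath E W' w x" and "E v w" and "W \<inter> W' = {}"
  shows "hpath E (W \<union> W') u x"
proof -
  from assms(1) obtain xs where xs: "xs \<noteq> []" "hd xs = u" "last xs = v" "distinct xs" "set xs = W"
    "successively E xs"
    unfolding hpath_def by blast
  from assms(2) obtain ys where ys: "ys \<noteq> []" "hd ys = w" "last ys = x" "distinct ys" "set ys = W'"
    "successively E ys"
    unfolding hpath_def by blast
  show ?thesis unfolding hpath_def
    by (rule exI[of _ "xs @ ys"]) (use xs ys assms(3,4) in \<open>auto simp: successively_append_iff\<close>)
qed

lemma hpath_listI:
  assumes "xs \<noteq> []" "distinct xs" "successively E xs" "hd xs = u" "last xs = v" "set xs = W"
  shows "hpath E W u v"
  using assms unfolding hpath_def by blast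

text \<open>The end of the path stays in \<open>G\<close>, and every vertex of \<open>G\<close>
  leads to the start of every segment. So the segments can be attached in any order.\<close>

lemma hpath_extend:
  assumes "hpath E W u v" and "v \<in> G" and "finite I"
    and "\<And>a. a \<in> I \<Longrightarrow> hpath E (F a) (s a) (t a)" and "\<And>a. a \<in> I \<Longrightarrow> t a \<in> G"
    and "\<And>g a. g \<in> G \<Longrightarrow> a \<in> I \<Longrightarrow> E g (s a)"
    and "\<And>a. a \<in> I \<Longrightarrow> W \<inter> F a = {}"
    and "\<And>a b. a \<in> I \<Longrightarrow> b \<in> I \<Longrightarrow> a \<noteq> b \<Longrightarrow> F a \<inter> F b = {}"
  shows "\<exists>v\<in>G. hpath E (W \<union> (\<Union>a\<in>I. F a)) u v"
  using assms(3-)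
proof (induction I rule: finite_induct)
  case empty
  then show ?case using assms(1,2) by auto
next
  case (insert a I)
  have "\<exists>g\<in>G. hpath E (W \<union> (\<Union>a\<in>I. F a)) u g"
  proof (rule insert.IH)
    show "F b \<inter> F b' = {}" if "b \<in> I" "b' \<in> I" "b \<noteq> b'" for b b'
      using insert.prems(5)[of b b'] that by simp
  qed (simp_all add: insert.prems)
  then obtain g where g: "g \<in> G" "hpath E (W \<union> (\<Union>a\<in>I. F a)) u g" by blast
  have "(W \<union> (\<Union>a\<in>I. F a)) \<inter> F a = {}"
    using insert.prems(4)[of a] insert.prems(5)[of _ a] insert.hyps(2) by blast
  then have "hpath E ((W \<union> (\<Union>a\<in>I. F a)) \<union> F a) u (t a)"
    by (intro hpath_append[OF g(2) insert.prems(1)] insert.prems(3) g) auto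
  moreover have "(W \<union> (\<Union>a\<in>I. F a)) \<union> F a = W \<union> (\<Union>a\<in>insert a I. F a)" by auto
  ultimately show ?case using insert.prems(2)[of a] by auto
qed

text \<open>The same with a prescribed last segment. The vertex set enters through a premise, so
  that the rule unifies with any description of it.\<close>

lemma hpath_sandwich:
  assumes "hpath E W u v" and "v \<in> G" and "hpath E W' w x" and "finite I"
    and "\<And>a. a \<in> I \<Longrightarrow> hpath E (F a) (s a) (t a)" and "\<And>a. a \<in> I \<Longrightarrow> t a \<in> G"
    and "\<And>g a. g \<in> G \<Longrightarrow> a \<in> I \<Longrightarrow> E g (s a)" and "\<And>g. g \<in> G \<Longrightarrow> E g w"
    and "\<And>a. a \<in> I \<Longrightarrow> W \<inter> F a = {}" and "\<And>a. a \<in> I \<Longrightarrow> W' \<inter> F a = {}" and "W \<inter> W' = {}"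
    and "\<And>a b. a \<in> I \<Longrightarrow> b \<in> I \<Longrightarrow> a \<noteq> b \<Longrightarrow> F a \<inter> F b = {}"
    and "V = W \<union> (\<Union>a\<in>I. F a) \<union> W'"
  shows "hpath E V u x"
proof -
  have "\<exists>g\<in>G. hpath E (W \<union> (\<Union>a\<in>I. F a)) u g"
    using assms(1,2,4,5,6,7,9,12) by (rule hpath_extend)
  then obtain g where "g \<in> G" "hpath E (W \<union> (\<Union>a\<in>I. F a)) u g" by blast
  then show ?thesis unfolding assms(13)
    using assms(10,11) by (intro hpath_append[OF _ assms(3)] assms(8)) blast+
qed

lemma hpath_image:
  assumes "hpath E W u v" and "inj_on f W"
    and "\<And>x y. x \<in> W \<Longrightarrow> y \<in> W \<Longrightarrow> E x y \<Longrightarrow> E' (f x) (f y)"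
  shows "hpath E' (f ` W) (f u) (f v)"
proof -
  from assms(1) obtain xs where xs: "xs \<noteq> []" "hd xs = u" "last xs = v" "distinct xs" "set xs = W"
    "successively E xs"
    unfolding hpath_def by blast
  have "successively (\<lambda>x y. E' (f x) (f y)) xs"
    using xs(6) by (rule successively_mono) (simp add: assms(3) xs(5))
  then show ?thesis unfolding hpath_def
    using xs(1-5) assms(2)
    by (intro exI[of _ "map f xs"] conjI) (simp_all add: hd_map last_map distinct_map
      successively_map)
qed

lemma hpath_ends: "hpath E W u v \<Longrightarrow> u \<in> W \<and> v \<in> W"
  unfolding hpath_def by (metis hd_in_set last_in_set)

lemma hcycle_image:
  assumes "hcycle E W" and "inj_on f W"
    and "\<And>x y. x \<in> W \<Longrightarrow> y \<in> W \<Longrightarrow> E x y \<Longrightarrow> E' (f x) (f y)"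
  shows "hcycle E' (f ` W)"
proof -
  from assms(1) obtain u v where uv: "hpath E W u v" "E v u" unfolding hcycle_def by blast
  have "hpath E' (f ` W) (f u) (f v)" by (rule hpath_image[OF uv(1) assms(2)]) (rule assms(3))
  moreover have "E' (f v) (f u)" using hpath_ends[OF uv(1)] uv(2) assms(3) by blast
  ultimately show ?thesis unfolding hcycle_def by blast
qed

text \<open>Walking around the cycle \<open>m\<close> times visits a new copy of every vertex in each round.\<close>

lemma hcycle_blow_up:
  assumes "hcycle E W" and "0 < (m::nat)"
  shows "hcycle (\<lambda>(x, j) (y, k). E x y) (W \<times> {..<m})"
proof -
  let ?E = "\<lambda>(x, j) (y, k). E x y"
  from assms(1) obtain u v where uv: "hpath E W u v" "E v u" unfolding hcycle_def by blast
  have copy: "hpath ?E (W \<times> {j}) (u, j) (v, j)" for j :: nat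
  proof -
    have "hpath ?E ((\<lambda>x. (x, j)) ` W) (u, j) (v, j)"
      by (rule hpath_image[OF uv(1)]) (auto simp: inj_on_def)
    moreover have "(\<lambda>x. (x, j)) ` W = W \<times> {j}" by auto
    ultimately show ?thesis by simp
  qed
  have "\<exists>w\<in>{v} \<times> UNIV. hpath ?E (W \<times> {0} \<union> (\<Union>j\<in>{1..<m}. W \<times> {j})) (u, 0) w"
    by (rule hpath_extend[OF copy, where s = "\<lambda>j. (u, j)" and t = "\<lambda>j. (v, j)"])
       (use copy uv(2) in auto)
  moreover have "W \<times> {0} \<union> (\<Union>j\<in>{1..<m}. W \<times> {j}) = W \<times> {..<m}"
    using assms(2) by (auto simp: Suc_le_eq)
  ultimately show ?thesis using uv(2) unfolding hcycle_def by auto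
qed

section \<open>Partitions into paths with both ends in a fixed set\<close>

inductive linked :: "('v \<Rightarrow> 'v \<Rightarrow> bool) \<Rightarrow> 'v set \<Rightarrow> 'v set \<Rightarrow> bool" for E K where
  empty: "linked E K {}"
| path: "linked E K W \<Longrightarrow> hpath E W' u v \<Longrightarrow> u \<in> K \<Longrightarrow> v \<in> K \<Longrightarrow> W \<inter> W' = {} \<Longrightarrow> linked E K (W \<union> W')"

lemma linked_hpath: "hpath E W u v \<Longrightarrow> u \<in> K \<Longrightarrow> v \<in> K \<Longrightarrow> linked E K W"
  using linked.path[OF linked.empty] by fastforce

lemma linked_Un: "linked E K W' \<Longrightarrow> linked E K W \<Longrightarrow> W \<inter> W' = {} \<Longrightarrow> linked E K (W \<union> W')"
proof (induction rule: linked.induct)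
  case (path X X' u v)
  then have "linked E K (W \<union> X)" by blast
  from linked.path[OF this path.hyps(2-4)] show ?case using path.hyps path.prems
    by (auto simp: Un_assoc)
qed simp

lemma linked_UN:
  "finite I \<Longrightarrow> (\<And>a. a \<in> I \<Longrightarrow> linked E K (F a)) \<Longrightarrow>
   (\<And>a b. a \<in> I \<Longrightarrow> b \<in> I \<Longrightarrow> a \<noteq> b \<Longrightarrow> F a \<inter> F b = {}) \<Longrightarrow> linked E K (\<Union>a\<in>I. F a)"
proof (induction I rule: finite_induct)
  case (insert a I)
  have "linked E K ((\<Union>a\<in>I. F a) \<union> F a)"
    by (rule linked_Un) (use insert in blast)+
  then show ?case by (simp add: Un_commute)
qed (simp add: linked.empty)

lemma linked_subset:
  assumes "finite W" and "W \<subseteq> K"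
  shows "linked E K W"
proof -
  have "linked E K (\<Union>x\<in>W. {x})"
    by (rule linked_UN[OF assms(1)]) (use assms(2) in \<open>auto intro: linked_hpath[OF hpath_single]\<close>)
  then show ?thesis by simp
qed

text \<open>The orbits of \<open>i\<close> are removed one at a time. For a fixed point the
  hypothesis on the orbit reads \<open>F c \<union> F c\<close>, so it is treated like the
  others.\<close>

lemma linked_involution:
  assumes "finite X" and "\<And>c. c \<in> X \<Longrightarrow> i c \<in> X" and "\<And>c. c \<in> X \<Longrightarrow> i (i c) = c"
    and "\<And>c. c \<in> X \<Longrightarrow> linked E K (F c \<union> F (i c))"
    and "\<And>c d. c \<in> X \<Longrightarrow> d \<in> X \<Longrightarrow> c \<noteq> d \<Longrightarrow> F c \<inter> F d = {}"
  shows "linked E K (\<Union>c\<in>X. F c)"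
  using assms
proof (induction X rule: finite_psubset_induct)
  case (psubset X)
  show ?case
  proof (cases "X = {}")
    case False
    then obtain c where c: "c \<in> X" by blast
    let ?Y = "X - {c, i c}"
    have Y: "i d \<in> ?Y" if "d \<in> ?Y" for d
    proof -
      have "i d \<noteq> c" "i d \<noteq> i c" "i d \<in> X"
        using that psubset.prems(1)[of d] psubset.prems(2)[of d] psubset.prems(2)[OF c]
          by (metis DiffE insertCI)+
      then show ?thesis by blast
    qed
    have "linked E K (\<Union>d\<in>?Y. F d)"
    proof (rule psubset.IH)
      show "?Y \<subset> X" using c by blast
      show "i d \<in> ?Y" if "d \<in> ?Y" for d by (rule Y[OF that])
      show "i (i d) = d" if "d \<in> ?Y" for d using psubset.prems(2) that by simp
      show "linked E K (F d \<union> F (i d))" if "d \<in> ?Y" for d using psubset.prems(3) that by simp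
      show "F d \<inter> F d' = {}" if "d \<in> ?Y" "d' \<in> ?Y" "d \<noteq> d'" for d d'
        using psubset.prems(4)[of d d'] that by simp
    qed
    then have "linked E K ((F c \<union> F (i c)) \<union> (\<Union>d\<in>?Y. F d))"
    proof (rule linked_Un)
      show "linked E K (F c \<union> F (i c))" by (rule psubset.prems(3)[OF c])
      have disj: "F b \<inter> F d = {}" if "b \<in> {c, i c}" "d \<in> ?Y" for b d
        by (rule psubset.prems(4)) (use that c psubset.prems(1)[OF c] in auto)
      show "(F c \<union> F (i c)) \<inter> (\<Union>d\<in>?Y. F d) = {}"
        using disj[of c] disj[of "i c"] by auto
    qed
    also have "F c \<union> F (i c) = (\<Union>d\<in>{c, i c}. F d)" by simp
    also have "(\<Union>d\<in>{c, i c}. F d) \<union> (\<Union>d\<in>?Y. F d) = (\<Union>d\<in>{c, i c} \<union> ?Y. F d)"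
      by (rule UN_Un [symmetric])
    also have "{c, i c} \<union> ?Y = X" using c psubset.prems(1)[OF c] by auto
    finally show ?thesis .
  next
    case True
    then show ?thesis by (simp add: linked.empty)
  qed
qed

text \<open>The end of each path leads to the start of the next, as \<open>K\<close> is a clique.
  Its loops are assumed too: they close the cycle in \<open>linked_imp_hcycle\<close> when the path
  is a single vertex.\<close>

lemma linked_imp_hpath:
  assumes "linked E K W" and "W \<noteq> {}" and "\<And>x y. x \<in> K \<Longrightarrow> y \<in> K \<Longrightarrow> E x y"
  shows "\<exists>u\<in>K. \<exists>v\<in>K. hpath E W u v"
  using assms
proof (induction rule: linked.induct)
  case (path W W' u v)
  then show ?case
    by (cases "W = {}") (auto, metis hpath_append)
qed simp

lemma linked_imp_hcycle:
  assumes "linked E K W" and "W \<noteq> {}" and "\<And>x y. x \<in> K \<Longrightarrow> y \<in> K \<Longrightarrow> E x y"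
  shows "hcycle E W"
  using linked_imp_hpath[OF assms] assms(3) unfolding hcycle_def by blast

text \<open>Every vertex of column c leads to every vertex of column i c and back, so a path can
  alternate between them, taking the rows in any order. The rows \<open>k\<close> and
  \<open>k'\<close> come first and last to put the ends into \<open>K\<close>. If i c = c, the
  segments shrink to single vertices and there are still two ends.\<close>

lemma linked_columns:
  assumes "finite D" and "finite X" and "\<And>c. c \<in> X \<Longrightarrow> i c \<in> X" and "\<And>c. c \<in> X \<Longrightarrow> i (i c) = c"
    and E: "\<And>c d d'. c \<in> X \<Longrightarrow> d \<in> D \<Longrightarrow> d' \<in> D \<Longrightarrow> E (d, c) (d', i c)"
    and k: "k \<in> D" "k' \<in> D" "k \<noteq> k'" and K: "{k, k'} \<times> X \<subseteq> K"
  shows "linked E K (D \<times> X)"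
proof -
  have "linked E K (\<Union>c\<in>X. D \<times> {c})"
  proof (rule linked_involution[where i = i])
    fix c assume c: "c \<in> X"
    have seg: "hpath E {(d, c), (d, i c)} (d, c) (d, i c)" if "d \<in> D" for d
      by (rule hpath_edge) (rule E[OF c that that])
    have "hpath E (D \<times> {c} \<union> D \<times> {i c}) (k, c) (k', i c)"
    proof (rule hpath_sandwich[OF seg[OF k(1)] _ seg[OF k(2)], where I = "D - {k, k'}"
      and G = "D \<times> {i c}"
          and F = "\<lambda>d. {(d, c), (d, i c)}" and s = "\<lambda>d. (d, c)" and t = "\<lambda>d. (d, i c)"])
      fix g d assume "g \<in> D \<times> {i c}" "d \<in> D - {k, k'}"
      then show "E g (d, c)" using E[of "i c"] assms(3,4) c by fastforce
    next
      fix g assume "g \<in> D \<times> {i c}"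
      then show "E g (k', c)" using E[of "i c"] assms(3,4) c k by fastforce
    next
      show "hpath E {(d, c), (d, i c)} (d, c) (d, i c)" if "d \<in> D - {k, k'}" for d
        by (rule seg) (use that in simp)
    qed (use k assms(1) in auto)
    then show "linked E K (D \<times> {c} \<union> D \<times> {i c})"
      by (rule linked_hpath) (use K c assms(3) in auto)
  next
    show "(D \<times> {c}) \<inter> (D \<times> {d}) = {}" if "c \<noteq> d" for c d using that by blast
  qed (simp_all add: assms)
  moreover have "(\<Union>c\<in>X. D \<times> {c}) = D \<times> X" by auto
  ultimately show ?thesis by simp
qed

section \<open>Relations on products of sets with involution\<close>

text \<open>What is kept of a corner of the reduced ring: \<open>z\<close> is its zero,
  \<open>u\<close> its identity and \<open>i\<close> the generalized inverse.\<close>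

locale pointed_involution =
  fixes C :: "'c set" and z u :: 'c and i :: "'c \<Rightarrow> 'c"
  assumes finite_C: "finite C" and z: "z \<in> C" and u: "u \<in> C" and z_neq_u: "z \<noteq> u"
    and inv_z: "i z = z" and inv_u: "i u = u"
    and inv_closed: "c \<in> C \<Longrightarrow> i c \<in> C" and inv_inv: "c \<in> C \<Longrightarrow> i (i c) = c"
begin

lemma inv_eq_iff: "c \<in> C \<Longrightarrow> d \<in> C \<Longrightarrow> i c = i d \<longleftrightarrow> c = d"
  using inv_inv by metis

lemma inv_eq_z: "c \<in> C \<Longrightarrow> i c = z \<longleftrightarrow> c = z"
  using inv_eq_iff z inv_z by metis

lemma inv_eq_u: "c \<in> C \<Longrightarrow> i c = u \<longleftrightarrow> c = u"
  using inv_eq_iff u inv_u by metis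

lemma inv_image: "i ` (C - {z, u}) = C - {z, u}"
proof
  show "i ` (C - {z, u}) \<subseteq> C - {z, u}" using inv_closed inv_eq_z inv_eq_u by auto
  show "C - {z, u} \<subseteq> i ` (C - {z, u})"
  proof
    fix c assume c: "c \<in> C - {z, u}"
    then have "i c \<in> C - {z, u}" "c = i (i c)" using inv_closed inv_eq_z inv_eq_u inv_inv by auto
    then show "c \<in> i ` (C - {z, u})" by blast
  qed
qed

text \<open>Made for several copies of \<int>_2 \<oplus> F: \<open>D\<close> holds the copies of
  both elements of the first factor, \<open>D'\<close> those of 1. Copies of (0, 0) are not
  vertices, so the column \<open>z\<close> contains only the rows \<open>D'\<close>. Two copies of 1
  supply the ends for \<open>linked_columns\<close>.\<close>

lemma hcycle_columns:
  assumes "finite D" and k: "k \<in> D'" "k' \<in> D'" "k \<noteq> k'" and D': "D' \<subseteq> D"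
    and E: "\<And>c d d'. c \<in> C - {z} \<Longrightarrow> d \<in> D \<Longrightarrow> d' \<in> D \<Longrightarrow> E (d, c) (d', i c)"
    and E': "\<And>d d' c c'. d \<in> D' \<Longrightarrow> d' \<in> D' \<Longrightarrow> c \<in> C \<Longrightarrow> c' \<in> C \<Longrightarrow> E (d, c) (d', c')"
  shows "hcycle E (D \<times> (C - {z}) \<union> D' \<times> {z})"
proof (rule linked_imp_hcycle[where K = "D' \<times> C"])
  show "linked E (D' \<times> C) (D \<times> (C - {z}) \<union> D' \<times> {z})"
  proof (rule linked_Un)
    show "linked E (D' \<times> C) (D \<times> (C - {z}))"
    proof (rule linked_columns[where i = i, OF assms(1)])
      show "i c \<in> C - {z}" if "c \<in> C - {z}" for c using that inv_closed inv_eq_z by auto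
      show "i (i c) = c" if "c \<in> C - {z}" for c using that inv_inv by auto
      show "{k, k'} \<times> (C - {z}) \<subseteq> D' \<times> C" using k by auto
    qed (use finite_C k D' E in auto)
    show "linked E (D' \<times> C) (D' \<times> {z})"
      by (rule linked_subset) (use z finite_subset[OF D' assms(1)] in auto)
  qed auto
  show "D \<times> (C - {z}) \<union> D' \<times> {z} \<noteq> {}" using k by auto
  show "E x y" if "x \<in> D' \<times> C" "y \<in> D' \<times> C" for x y using E' that by auto
qed

text \<open>The rows \<open>p\<close> and \<open>q\<close> stand for 0 and 1 of \<int>_2. In a
  self-inverse column c the only other vertex that (p, c) is sure to be joined to is (q, c), so (p,
  c) is made an end of the path. By \<open>fix1\<close> there are at most two such columns besides
  \<open>z\<close>, one for each end.\<close>

lemma hpath_two_rows: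
  assumes fix1: "\<And>b b'. b \<in> C - {z, u} \<Longrightarrow> b' \<in> C - {z, u} \<Longrightarrow> i b = b \<Longrightarrow> i b' = b' \<Longrightarrow> b = b'"
    and EC: "\<And>c d d'. c \<in> C - {z} \<Longrightarrow> d \<in> {p, q} \<Longrightarrow> d' \<in> {p, q} \<Longrightarrow> E (d, c) (d', i c)"
    and Eq: "\<And>c c'. c \<in> C \<Longrightarrow> c' \<in> C \<Longrightarrow> E (q, c) (q, c')"
    and pq: "p \<noteq> q"
  shows "\<exists>v w. hpath E ({p, q} \<times> C - {(p, z)}) v w"
proof -
  let ?K = "{q} \<times> C" and ?X = "{b \<in> C - {z}. i b \<noteq> b}"
  have "linked E ?K (\<Union>b\<in>?X. {p, q} \<times> {b})"
  proof (rule linked_involution[where i = i])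
    fix b assume b: "b \<in> ?X"
    then have ib: "i b \<in> ?X" using inv_closed inv_eq_z inv_inv by auto
    have E1: "E (d, b) (d', i b)" "E (d, i b) (d', b)" if "d \<in> {p, q}" "d' \<in> {p, q}" for d d'
      using EC[of b d d'] EC[of "i b" d d'] b ib inv_inv[of b] that by auto
    \<comment> \<open>An inverse pair of columns is traversed with both ends in the clique row
      \<open>q\<close>.\<close>
    have "hpath E ({p, q} \<times> {b} \<union> {p, q} \<times> {i b}) (q, i b) (q, b)"
      by (rule hpath_listI[where xs = "[(q, i b), (p, b), (p, i b), (q, b)]"])
         (use E1 b pq in auto)
    then show "linked E ?K ({p, q} \<times> {b} \<union> {p, q} \<times> {i b})"
      by (rule linked_hpath) (use b ib in auto)
    show "i b \<in> ?X" by (fact ib)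
    show "i (i b) = b" using inv_inv b by simp
  qed (use finite_C in auto)
  then have "linked E ?K ((\<Union>b\<in>?X. {p, q} \<times> {b}) \<union> {(q, z)})"
    by (rule linked_Un[rotated]) (use z in \<open>auto intro: linked_subset\<close>)
  then obtain v w where vw: "v \<in> ?K" "w \<in> ?K"
    and path: "hpath E ((\<Union>b\<in>?X. {p, q} \<times> {b}) \<union> {(q, z)}) v w"
    using linked_imp_hpath[of E ?K "(\<Union>b\<in>?X. {p, q} \<times> {b}) \<union> {(q, z)}"] Eq by auto
  have u': "u \<in> C - {z}" using u z_neq_u by auto
  have "hpath E {(p, u), (q, u)} (p, u) (q, u)"
    by (rule hpath_edge) (use EC[OF u', of p q] inv_u in simp)
  then have path': "hpath E ({(p, u), (q, u)} \<union> ((\<Union>b\<in>?X. {p, q} \<times> {b}) \<union> {(q, z)})) (p, u) w"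
    using path by (rule hpath_append) (use Eq u vw inv_u z_neq_u in auto)
  show ?thesis
  proof (cases "\<exists>b\<in>C - {z, u}. i b = b")
    \<comment> \<open>In a field of odd characteristic this second self-inverse column is that of
      -1.\<close>
    case True
    then obtain b where b: "b \<in> C - {z, u}" "i b = b" by blast
    have "hpath E {(q, b), (p, b)} (q, b) (p, b)"
      by (rule hpath_edge) (use EC[of b q p] b in simp)
    with path' have "hpath E (({(p, u), (q, u)} \<union> ((\<Union>b\<in>?X. {p, q} \<times> {b}) \<union> {(q, z)})) \<union> {(q, b), (p,
        b)}) (p, u) (p, b)"
      by (rule hpath_append) (use Eq vw b in auto)
    moreover have "({(p, u), (q, u)} \<union> ((\<Union>b\<in>?X. {p, q} \<times> {b}) \<union> {(q, z)})) \<union> {(q, b), (p, b)}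
      = {p, q} \<times> C - {(p, z)}"
    proof -
      have "c = b" if "c \<in> C - {z, u}" "i c = c" for c
        by (rule fix1[OF that(1) b(1) that(2) b(2)])
      then have C: "{z, u, b} \<union> ?X = C" using b z u by blast
      have "({(p, u), (q, u)} \<union> ((\<Union>b\<in>?X. {p, q} \<times> {b}) \<union> {(q, z)})) \<union> {(q, b), (p, b)}
        = {p, q} \<times> ({z, u, b} \<union> ?X) - {(p, z)}"
        using pq b u' by auto
      then show ?thesis unfolding C .
    qed
    ultimately show ?thesis by auto
  next
    case False
    have C: "{z, u} \<union> ?X = C" using False z u by auto
    have "({(p, u), (q, u)} \<union> ((\<Union>b\<in>?X. {p, q} \<times> {b}) \<union> {(q, z)})) = {p, q} \<times> ({z, u} \<union> ?X) - {(p,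
        z)}"
      using pq u' by auto
    then have "hpath E ({p, q} \<times> C - {(p, z)}) (p, u) w" using path' unfolding C by (simp only:)
    then show ?thesis by blast
  qed
qed

end

section \<open>Cycles on a product of three factors\<close>

lemma hcycle_three_factors:
  fixes P :: "'a set" and Q :: "'b set" and C :: "'c set"
  assumes "pointed_involution P zP uP iP" and "pointed_involution Q zQ uQ iQ"
    and "pointed_involution C zC uC iC"
    and EP: "\<And>x y y' c c'. x \<in> P - {zP} \<Longrightarrow> y \<in> Q \<Longrightarrow> y' \<in> Q \<Longrightarrow> c \<in> C \<Longrightarrow> c' \<in> C \<Longrightarrow> E ((x, y), c) ((iP x,
        y'), c')"
    and EQ: "\<And>x x' y c c'. x \<in> P \<Longrightarrow> x' \<in> P \<Longrightarrow> y \<in> Q - {zQ} \<Longrightarrow> c \<in> C \<Longrightarrow> c' \<in> C \<Longrightarrow> E ((x, y), c) ((x', iQ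
        y), c')"
    and EC: "\<And>x x' y y' c. x \<in> P \<Longrightarrow> x' \<in> P \<Longrightarrow> y \<in> Q \<Longrightarrow> y' \<in> Q \<Longrightarrow> c \<in> C - {zC} \<Longrightarrow> E ((x, y), c) ((x', y'),
        iC c)"
  shows "hcycle E ((P \<times> Q) \<times> C - {((zP, zQ), zC)})"
proof -
  interpret P: pointed_involution P zP uP iP by fact
  interpret Q: pointed_involution Q zQ uQ iQ by fact
  interpret C: pointed_involution C zC uC iC by fact
  \<comment> \<open>The tuples are sorted by the third coordinate, with \<open>zC\<close> and
    \<open>uC\<close> set apart, and these by the second, with \<open>zQ\<close> and
    \<open>uQ\<close> set apart. The block left over contains the excluded zero tuple and the
    critical vertices ((w, zQ), zC).\<close>
  let ?K = "({uP} \<times> Q) \<times> C"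
  let ?P = "P - {zP, uP}" and ?Q = "Q - {zQ, uQ}" and ?C = "C - {zC, uC}"
  note pts = P.z P.u P.z_neq_u Q.z Q.u Q.z_neq_u C.z C.u C.z_neq_u
  \<comment> \<open>The tuples with last coordinate \<open>uC\<close> form a second clique. It is
    the gate through which the rows of the last block are chained.\<close>
  have E1: "E ((x, y), uC) ((x', y'), uC)" if "x \<in> P" "x' \<in> P" "y \<in> Q" "y' \<in> Q" for x x' y y'
    using EC[of x x' y y' uC] that pts C.inv_u by auto
  have K: "E v w" if "v \<in> ?K" "w \<in> ?K" for v w
    using that EP[of uP] pts P.inv_u by auto
  have L1: "linked E ?K ((P \<times> Q) \<times> ?C)"
  proof (rule linked_columns[where i = iC and k = "(uP, uQ)" and k' = "(uP, zQ)"])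
    show "iC c \<in> ?C" if "c \<in> ?C" for c using that C.inv_closed C.inv_eq_u C.inv_eq_z by auto
    show "iC (iC c) = c" if "c \<in> ?C" for c using that C.inv_inv by auto
  qed (use pts P.finite_C Q.finite_C C.finite_C EC in auto)
  \<comment> \<open>Pairing y at \<open>zC\<close> with iQ y at \<open>uC\<close> treats
    self-inverse y like all others and gives each path two vertices of \<open>K\<close> as ends.
    Since \<open>iQ\<close> permutes \<open>?Q\<close>, everything is covered.\<close>
  have L2: "linked E ?K (\<Union>y\<in>?Q. (P \<times> {y}) \<times> {zC} \<union> (P \<times> {iQ y}) \<times> {uC})"
  proof (rule linked_UN)
    fix y assume y: "y \<in> ?Q"
    then have iy: "iQ y \<in> ?Q" "iQ (iQ y) = y" using Q.inv_closed Q.inv_eq_u Q.inv_eq_z Q.inv_inv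
      by auto
    have E2: "E ((w, y), c) ((w', iQ y), c')" "E ((w, iQ y), c) ((w', y), c')"
      if "w \<in> P" "w' \<in> P" "c \<in> C" "c' \<in> C" for w w' c c'
      using EQ[of w w' y c c'] EQ[of w w' "iQ y" c c'] that y iy by auto
    have "hpath E ((P \<times> {y}) \<times> {zC} \<union> (P \<times> {iQ y}) \<times> {uC}) ((uP, iQ y), uC) ((uP, y), zC)"
    proof (rule hpath_sandwich[OF hpath_single _ hpath_single, where I = "P - {uP}"
          and F = "\<lambda>w. {((w, y), zC), ((w, iQ y), uC)}" and s = "\<lambda>w. ((w, y), zC)"
          and t = "\<lambda>w. ((w, iQ y), uC)" and G = "(P \<times> {iQ y}) \<times> {uC}"])
      show "hpath E {((w, y), zC), ((w, iQ y), uC)} ((w, y), zC) ((w, iQ y), uC)"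
        if "w \<in> P - {uP}" for w
        by (rule hpath_edge) (use that E2 pts in auto)
    qed (use E2 pts P.finite_C in auto)
    then show "linked E ?K ((P \<times> {y}) \<times> {zC} \<union> (P \<times> {iQ y}) \<times> {uC})"
      by (rule linked_hpath) (use y iy pts in auto)
  qed (use Q.finite_C Q.inv_eq_iff pts in auto)
  let ?F = "\<lambda>w. {((w, uQ), uC), ((w, uQ), zC), ((iP w, zQ), zC), ((w, zQ), uC)}"
  let ?W1 = "{((uP, uQ), uC), ((zP, uQ), zC), ((zP, uQ), uC)}"
    and ?W2 = "{((zP, zQ), uC), ((uP, zQ), uC)}"
  have EuQ: "E ((x, uQ), c) ((x', uQ), c')" if "x \<in> P" "x' \<in> P" "c \<in> C" "c' \<in> C" for x x' c c'
    using EQ[of x x' uQ c c'] that pts Q.inv_u by auto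
  have iP: "iP w \<in> ?P" "iP (iP w) = w" if "w \<in> ?P" for w
    using that P.inv_closed P.inv_eq_u P.inv_eq_z P.inv_inv by auto
  \<comment> \<open>The vertex \<open>((w, zQ), zC)\<close> is adjacent to nothing but the row of \<open>iP w\<close>, so each row inserts
    the corresponding vertex of its inverse row.\<close>
  have "hpath E (?W1 \<union> (\<Union>w\<in>?P. ?F w) \<union> ?W2) ((uP, uQ), uC) ((uP, zQ), uC)"
  proof (rule hpath_sandwich[where F = ?F and s = "\<lambda>w. ((w, uQ), uC)" and t = "\<lambda>w. ((w, zQ), uC)"
        and G = "(P \<times> Q) \<times> {uC}" and I = ?P])
    show "hpath E ?W1 ((uP, uQ), uC) ((zP, uQ), uC)"
      by (rule hpath_listI[where xs = "[((uP, uQ), uC), ((zP, uQ), zC), ((zP, uQ), uC)]"])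
         (use pts EuQ in auto)
    show "hpath E ?W2 ((zP, zQ), uC) ((uP, zQ), uC)"
      by (rule hpath_edge) (use pts E1 in auto)
    show "hpath E (?F w) ((w, uQ), uC) ((w, zQ), uC)" if "w \<in> ?P" for w
      by (rule hpath_listI[where xs = "[((w, uQ), uC), ((w, uQ), zC), ((iP w, zQ), zC), ((w, zQ),
          uC)]"])
         (use that iP[OF that] pts EuQ EP[of w] EP[of "iP w"] in auto)
    show "?F w \<inter> ?F w' = {}" if "w \<in> ?P" "w' \<in> ?P" "w \<noteq> w'" for w w'
      using that P.inv_eq_iff[of w w'] pts by auto
  qed (use pts P.finite_C E1 in auto)
  moreover have "(\<Union>w\<in>?P. ?F w) = (?P \<times> {uQ}) \<times> {uC} \<union> (?P \<times> {uQ}) \<times> {zC} \<union> (iP ` ?P \<times> {zQ}) \<times> {zC} \<union>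
      (?P \<times> {zQ}) \<times> {uC}"
    by auto
  ultimately have L3: "linked E ?K (?W1 \<union> ((?P \<times> {uQ}) \<times> {uC} \<union> (?P \<times> {uQ}) \<times> {zC} \<union> (?P \<times> {zQ}) \<times>
      {zC} \<union> (?P \<times> {zQ}) \<times> {uC}) \<union> ?W2)"
    unfolding P.inv_image by (intro linked_hpath) (use pts in auto)
  have L4: "linked E ?K {((uP, uQ), zC), ((uP, zQ), zC)}"
    by (rule linked_subset) (use pts in auto)
  have eq2: "(\<Union>y\<in>?Q. (P \<times> {y}) \<times> {zC} \<union> (P \<times> {iQ y}) \<times> {uC}) = (P \<times> ?Q) \<times> {zC} \<union> (P \<times> iQ ` ?Q) \<times>
      {uC}"
    by auto
  let ?V34 = "(?W1 \<union> ((?P \<times> {uQ}) \<times> {uC} \<union> (?P \<times> {uQ}) \<times> {zC} \<union> (?P \<times> {zQ}) \<times> {zC} \<union> (?P \<times> {zQ}) \<times>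
      {uC}) \<union> ?W2) \<union> {((uP, uQ), zC), ((uP, zQ), zC)}"
  have "?V34 = (P \<times> {uQ, zQ}) \<times> {uC, zC} - {((zP, zQ), zC)}"
  proof (rule Set.set_eqI)
    fix v :: "('a \<times> 'b) \<times> 'c"
    obtain x y c where v: "v = ((x, y), c)" by (metis surj_pair)
    show "v \<in> ?V34 \<longleftrightarrow> v \<in> (P \<times> {uQ, zQ}) \<times> {uC, zC} - {((zP, zQ), zC)}"
      unfolding v using pts
      by (cases "x = zP"; cases "x = uP"; cases "y = uQ"; cases "c = uC") auto
  qed
  moreover have "linked E ?K ?V34"
    by (rule linked_Un[OF L4 L3]) (use pts in auto)
  ultimately have L34: "linked E ?K ((P \<times> {uQ, zQ}) \<times> {uC, zC} - {((zP, zQ), zC)})" by simp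
  have "linked E ?K ((P \<times> ?Q) \<times> {zC} \<union> (P \<times> ?Q) \<times> {uC})"
    using L2 unfolding eq2 Q.inv_image .
  then have "linked E ?K (((P \<times> ?Q) \<times> {zC} \<union> (P \<times> ?Q) \<times> {uC}) \<union> ((P \<times> {uQ, zQ}) \<times> {uC, zC} - {((zP,
      zQ), zC)}))"
    by (intro linked_Un[OF L34]) auto
  then have "linked E ?K ((P \<times> Q) \<times> ?C \<union> (((P \<times> ?Q) \<times> {zC} \<union> (P \<times> ?Q) \<times> {uC}) \<union> ((P \<times> {uQ, zQ}) \<times>
      {uC, zC} - {((zP, zQ), zC)})))"
    by (rule linked_Un[OF _ L1]) auto
  moreover have "(P \<times> Q) \<times> ?C \<union> (((P \<times> ?Q) \<times> {zC} \<union> (P \<times> ?Q) \<times> {uC}) \<union> ((P \<times> {uQ, zQ}) \<times> {uC, zC} -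
      {((zP, zQ), zC)}))
     = (P \<times> Q) \<times> C - {((zP, zQ), zC)}"
    using pts by auto
  ultimately have "linked E ?K ((P \<times> Q) \<times> C - {((zP, zQ), zC)})" by simp
  moreover have "((uP, zQ), zC) \<in> (P \<times> Q) \<times> C - {((zP, zQ), zC)}" using pts by auto
  ultimately show ?thesis
    using K by (intro linked_imp_hcycle[where K = ?K]) blast+
qed

text \<open>Modelled on two fields other than \<int>_2: \<open>A3\<close> and \<open>B3\<close>
  provide a third element, and \<open>fixA\<close> and \<open>fixB\<close> say that at most one
  element besides zero and identity is self-inverse, as is -1 in a field.\<close>

locale two_factors = A: pointed_involution A zA uA iA + B: pointed_involution B zB uB iB
  for A :: "'a set" and zA uA iA and B :: "'b set" and zB uB iB +
  fixes E :: "'a \<times> 'b \<Rightarrow> 'a \<times> 'b \<Rightarrow> bool"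
  assumes EA: "a \<in> A - {zA} \<Longrightarrow> b \<in> B \<Longrightarrow> b' \<in> B \<Longrightarrow> E (a, b) (iA a, b')"
    and EB: "a \<in> A \<Longrightarrow> a' \<in> A \<Longrightarrow> b \<in> B - {zB} \<Longrightarrow> E (a, b) (a', iB b)"
    and A3: "A - {zA, uA} \<noteq> {}" and B3: "B - {zB, uB} \<noteq> {}"
    and fixA: "a \<in> A - {zA, uA} \<Longrightarrow> a' \<in> A - {zA, uA} \<Longrightarrow> iA a = a \<Longrightarrow> iA a' = a' \<Longrightarrow> a = a'"
    and fixB: "b \<in> B - {zB, uB} \<Longrightarrow> b' \<in> B - {zB, uB} \<Longrightarrow> iB b = b \<Longrightarrow> iB b' = b' \<Longrightarrow> b = b'"
begin

lemmas pts = A.z A.u A.z_neq_u B.z B.u B.z_neq_u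

lemma EB_fixed: "a \<in> A \<Longrightarrow> a' \<in> A \<Longrightarrow> b \<in> B - {zB} \<Longrightarrow> iB b = b \<Longrightarrow> E (a, b) (a', b)"
  using EB[of a a' b] by simp

lemma EuB: "a \<in> A \<Longrightarrow> a' \<in> A \<Longrightarrow> E (a, uB) (a', uB)"
  using EB_fixed pts B.inv_u by auto

text \<open>The vertices of the column \<open>zB\<close> are inserted between the columns \<open>c\<close> and \<open>iB c\<close>. A path
  through the column \<open>uB\<close> can leave it only along a row and returns to the clique through another
  column, which is the second fixed one if it exists and the pair \<open>c\<close>, \<open>iB c\<close> otherwise.\<close>

lemma hcycle_of_pair:
  assumes c: "c \<in> B" "iB c \<noteq> c"
  shows "hcycle E (A \<times> B - {(zA, zB)})"
proof -
  let ?K = "{uA} \<times> B" and ?A = "A - {zA, uA}"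
  have K: "E v w" if "v \<in> ?K" "w \<in> ?K" for v w
    using that EA[of uA] pts A.inv_u by auto
  have cz: "c \<in> B - {zB, uB}" "iB c \<in> B - {zB, uB}" "iB (iB c) = c"
    using c B.inv_closed B.inv_inv B.inv_z B.inv_u B.inv_eq_z B.inv_eq_u by auto
  have iA: "iA w \<in> ?A" "iA (iA w) = w" if "w \<in> ?A" for w
    using that A.inv_closed A.inv_eq_u A.inv_eq_z A.inv_inv by auto
  have Ec: "E (a, c) (a', iB c)" "E (a, iB c) (a', c)" if "a \<in> A" "a' \<in> A" for a a'
    using EB[of a a' c] EB[of a a' "iB c"] that cz by auto
  \<comment> \<open>The column \<open>uB\<close> meets \<open>?K\<close> only in (uA, uB), and the
    edges known at (zA, uB) stay inside the column. A path that starts in (uA, uB) therefore leaves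
    the column through a third row x.\<close>
  obtain x where x: "x \<in> ?A" using A3 by blast
  \<comment> \<open>The vertex (iA w, zB) is sure to be joined only to the row w, so it sits between
    two vertices of that row. As \<open>iA\<close> permutes \<open>?A\<close>, each such vertex is
    used once.\<close>
  let ?S = "\<lambda>w. {(w, c), (iA w, zB), (w, iB c)}"
  have S: "hpath E (?S w) (w, c) (w, iB c)" if "w \<in> ?A" for w
  proof (rule hpath_listI[where xs = "[(w, c), (iA w, zB), (w, iB c)]"])
    have "E (w, c) (iA w, zB)" "E (iA w, zB) (w, iB c)"
      using EA[of w c zB] EA[of "iA w" zB "iB c"] iA[OF that] that cz pts by auto
    then show "successively E [(w, c), (iA w, zB), (w, iB c)]" by simp
  qed (use that cz c in auto)
  have S_disj: "?S w \<inter> ?S w' = {}" if "w \<in> ?A" "w' \<in> ?A" "w \<noteq> w'" for w w'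
    using that A.inv_eq_iff[of w w'] cz by auto
  have S_un: "(\<Union>w\<in>?A. ?S w) = ?A \<times> {c, zB, iB c}"
  proof -
    have "(\<Union>w\<in>?A. ?S w) = ?A \<times> {c} \<union> iA ` ?A \<times> {zB} \<union> ?A \<times> {iB c}" by auto
    then show ?thesis unfolding A.inv_image by auto
  qed
  let ?F = "{b \<in> B - {zB, uB}. iB b = b}" and ?X = "{b \<in> B - {zB, c, iB c}. iB b \<noteq> b}"
  have LX: "linked E ?K (A \<times> ?X)"
  proof -
    have "linked E ?K (\<Union>b\<in>?X. A \<times> {b})"
    proof (rule linked_involution[where i = iB])
      fix b assume b: "b \<in> ?X"
      have "iB b \<noteq> iB c" using B.inv_eq_iff[of b c] b cz by auto
      moreover have "iB b \<noteq> iB (iB c)" using B.inv_eq_iff[of b "iB c"] b cz by auto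
      moreover show bb: "iB (iB b) = b" using b B.inv_inv by simp
      moreover have "iB b \<in> B" "iB b \<noteq> zB" using b B.inv_closed B.inv_eq_z by simp_all
      moreover have "b \<noteq> iB b" using b by (simp add: not_sym)
      ultimately show ib: "iB b \<in> ?X" using b cz(3) by simp
      have Eb: "E (a, b) (a', iB b)" "E (a, iB b) (a', b)" if "a \<in> A" "a' \<in> A" for a a'
        using EB[of a a' b] EB[of a a' "iB b"] that b ib bb by auto
      \<comment> \<open>Only the row \<open>uA\<close> lies in \<open>?K\<close>, so the first and
        the last segment cross between the rows \<open>uA\<close> and \<open>zA\<close> to have both
        ends there.\<close>
      have "hpath E (A \<times> {b} \<union> A \<times> {iB b}) (uA, b) (uA, iB b)"
      proof (rule hpath_sandwich[where I = ?A and F = "\<lambda>w. {(w, b), (w, iB b)}" and s = "\<lambda>w. (w, b)"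
            and t = "\<lambda>w. (w, iB b)" and G = "A \<times> {iB b}" and v = "(zA, iB b)" and w = "(zA, b)"])
        show "hpath E {(uA, b), (zA, iB b)} (uA, b) (zA, iB b)" "hpath E {(zA, b), (uA, iB b)} (zA,
            b) (uA, iB b)"
          by (rule hpath_edge, use Eb pts in auto)+
        show "hpath E {(w, b), (w, iB b)} (w, b) (w, iB b)" if "w \<in> ?A" for w
          by (rule hpath_edge) (use Eb that in auto)
      qed (use A.finite_C Eb pts b in auto)
      then show "linked E ?K (A \<times> {b} \<union> A \<times> {iB b})"
        by (rule linked_hpath) (use b ib in auto)
    qed (use B.finite_C in auto)
    moreover have "(\<Union>b\<in>?X. A \<times> {b}) = A \<times> ?X" by auto
    ultimately show ?thesis by simp
  qed
  let ?Y = "A \<times> {uB, c, iB c} \<union> ?A \<times> {zB} \<union> A \<times> ?F"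
  have P1: "hpath E (A \<times> {uB} - {(uA, uB)} \<union> {(uA, uB)}) (uA, uB) (x, uB)"
  proof (rule hpath_sandwich[OF _ _ hpath_single, where I = "?A - {x}" and F = "\<lambda>w. {(w, uB)}"
    and s = "\<lambda>w. (w, uB)"
        and t = "\<lambda>w. (w, uB)" and G = "A \<times> {uB}" and v = "(zA, uB)"])
    show "hpath E {(uA, uB), (zA, uB)} (uA, uB) (zA, uB)" by (rule hpath_edge) (use EuB pts in auto)
  qed (use A.finite_C EuB pts x hpath_single in auto)
  then have P1: "hpath E (A \<times> {uB}) (uA, uB) (x, uB)"
    using pts by (simp add: insert_absorb)
  have LY: "linked E ?K ?Y"
  proof (cases "?F = {}")
    case True
    have "hpath E (A \<times> {c, iB c} \<union> ?A \<times> {zB}) (iA x, c) (uA, iB c)"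
    proof (rule hpath_sandwich[OF S, where I = "?A - {iA x}" and F = ?S and s = "\<lambda>w. (w, c)"
          and t = "\<lambda>w. (w, iB c)" and G = "A \<times> {iB c}" and W' = "{zA, uA} \<times> {c, iB c}"
            and w = "(zA, c)"])
      \<comment> \<open>The rows \<open>zA\<close> and \<open>uA\<close> have no segment
        \<open>?S\<close>. They come last, so that the path ends in \<open>?K\<close>.\<close>
      show "hpath E ({zA, uA} \<times> {c, iB c}) (zA, c) (uA, iB c)"
        by (rule hpath_listI[where xs = "[(zA, c), (zA, iB c), (uA, c), (uA, iB c)]"])
           (use Ec pts c in auto)
      show "?S (iA x) \<inter> ?S w = {}" if "w \<in> ?A - {iA x}" for w
        by (rule S_disj) (use that iA[OF x] in auto)
      show "?S w \<inter> ?S w' = {}" if "w \<in> ?A - {iA x}" "w' \<in> ?A - {iA x}" "w \<noteq> w'" for w w'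
        by (rule S_disj) (use that in auto)
      have "?S (iA x) \<union> (\<Union>w\<in>?A - {iA x}. ?S w) = (\<Union>w\<in>?A. ?S w)" using iA[OF x] by blast
      then show "A \<times> {c, iB c} \<union> ?A \<times> {zB} = ?S (iA x) \<union> (\<Union>w\<in>?A - {iA x}. ?S w) \<union> {zA, uA} \<times> {c, iB
          c}"
        unfolding S_un using pts by auto
      show "hpath E (?S w) (w, c) (w, iB c)" if "w \<in> ?A - {iA x}" for w
        by (rule S) (use that in auto)
      show "({zA, uA} \<times> {c, iB c}) \<inter> ?S w = {}" if "w \<in> ?A - {iA x}" for w
        using that cz by auto
      show "?S (iA x) \<inter> ({zA, uA} \<times> {c, iB c}) = {}" using iA[OF x] cz by auto
    qed (use A.finite_C Ec pts iA[OF x] in auto)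
    with P1 have "hpath E (A \<times> {uB} \<union> (A \<times> {c, iB c} \<union> ?A \<times> {zB})) (uA, uB) (uA, iB c)"
      by (rule hpath_append) (use EA[of x uB c] x cz pts in auto)
    moreover have "A \<times> {uB} \<union> (A \<times> {c, iB c} \<union> ?A \<times> {zB}) = ?Y" unfolding True by auto
    ultimately show ?thesis by (intro linked_hpath) (use pts cz in auto)
  next
    case False
    then obtain d where d: "d \<in> ?F" by blast
    have F: "?F = {d}" using fixB d by blast
    have Ed: "E (a, d) (a', d)" if "a \<in> A" "a' \<in> A" for a a'
      using EB_fixed[of a a' d] that d by auto
    have "hpath E (A \<times> {d}) (iA x, d) (uA, d)"
    proof (rule hpath_sandwich[OF hpath_single, where I = "?A - {iA x}" and F = "\<lambda>w. {(w, d)}"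
      and s = "\<lambda>w. (w, d)"
          and t = "\<lambda>w. (w, d)" and G = "A \<times> {d}" and w = "(zA, d)"])
      show "hpath E {(zA, d), (uA, d)} (zA, d) (uA, d)" by (rule hpath_edge) (use Ed pts in auto)
    qed (use A.finite_C Ed pts iA[OF x] hpath_single in auto)
    with P1 have "hpath E (A \<times> {uB} \<union> A \<times> {d}) (uA, uB) (uA, d)"
      by (rule hpath_append) (use EA[of x uB d] x d pts in auto)
    then have L1: "linked E ?K (A \<times> {uB} \<union> A \<times> {d})"
      by (rule linked_hpath) (use pts d in auto)
    \<comment> \<open>Since the column d already takes the path from \<open>uB\<close> back to
      \<open>?K\<close>, the pair c, iB c forms a path of its own.\<close>
    have "hpath E (A \<times> {c, iB c} \<union> ?A \<times> {zB}) (uA, c) (uA, iB c)"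
    proof (rule hpath_sandwich[where I = ?A and F = ?S and s = "\<lambda>w. (w, c)"
          and t = "\<lambda>w. (w, iB c)" and G = "A \<times> {iB c}" and v = "(zA, iB c)"
            and w = "(zA, c)", OF _ _ _ _ S _ _ _ _ _ _ S_disj])
      show "hpath E {(uA, c), (zA, iB c)} (uA, c) (zA, iB c)" "hpath E {(zA, c), (uA, iB c)} (zA, c)
          (uA, iB c)"
        by (rule hpath_edge, use Ec pts in auto)+
      show "A \<times> {c, iB c} \<union> ?A \<times> {zB} = {(uA, c), (zA, iB c)} \<union> (\<Union>w\<in>?A. ?S w) \<union> {(zA, c), (uA, iB
          c)}"
        unfolding S_un using pts by auto
    qed (use A.finite_C Ec pts c cz in auto)
    then have "linked E ?K (A \<times> {c, iB c} \<union> ?A \<times> {zB})"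
      by (rule linked_hpath) (use pts cz in auto)
    then have "linked E ?K ((A \<times> {uB} \<union> A \<times> {d}) \<union> (A \<times> {c, iB c} \<union> ?A \<times> {zB}))"
      by (rule linked_Un[OF _ L1]) (use d cz pts c in auto)
    moreover have "(A \<times> {uB} \<union> A \<times> {d}) \<union> (A \<times> {c, iB c} \<union> ?A \<times> {zB}) = ?Y" unfolding F by auto
    ultimately show ?thesis by simp
  qed
  have "linked E ?K {(uA, zB)}" by (rule linked_subset) (use pts in auto)
  then have "linked E ?K (A \<times> ?X \<union> {(uA, zB)})"
    by (rule linked_Un[OF _ LX]) (use pts in auto)
  then have "linked E ?K (?Y \<union> (A \<times> ?X \<union> {(uA, zB)}))"
    by (rule linked_Un[OF _ LY]) (use pts cz B.inv_u in auto)
  moreover have "?Y \<union> (A \<times> ?X \<union> {(uA, zB)}) = A \<times> B - {(zA, zB)}"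
    using pts cz B.inv_u by auto
  ultimately have "linked E ?K (A \<times> B - {(zA, zB)})" by simp
  moreover have "(uA, zB) \<in> A \<times> B - {(zA, zB)}" using pts by auto
  ultimately show ?thesis
    using K by (intro linked_imp_hcycle[where K = ?K]) blast+
qed

text \<open>If all elements are self-inverse, then \<open>fixA\<close> and \<open>fixB\<close> leave
  three elements on each side. This is \<int>_3 \<oplus> \<int>_3, for which a cycle through the
  eight vertices is written down.\<close>

lemma hcycle_of_fixed:
  assumes iA: "\<And>a. a \<in> A \<Longrightarrow> iA a = a" and iB: "\<And>b. b \<in> B \<Longrightarrow> iB b = b"
  shows "hcycle E (A \<times> B - {(zA, zB)})"
proof -
  obtain a b where ab: "a \<in> A - {zA, uA}" "b \<in> B - {zB, uB}" using A3 B3 by blast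
  have EA': "E (x, y) (x, y')" if "x \<in> A - {zA}" "y \<in> B" "y' \<in> B" for x y y'
    using EA[OF that] iA that by auto
  have EB': "E (x, y) (x', y)" if "x \<in> A" "x' \<in> A" "y \<in> B - {zB}" for x x' y
    using EB[OF that] iB that by auto
  have "A - {zA, uA} = {a}" using fixA[OF _ ab(1)] iA ab(1) by blast
  then have A: "A = {zA, uA, a}" using pts by blast
  have "B - {zB, uB} = {b}" using fixB[OF _ ab(2)] iB ab(2) by blast
  then have B: "B = {zB, uB, b}" using pts by blast
  have "hpath E (A \<times> B - {(zA, zB)}) (uA, zB) (uA, b)"
  proof (rule hpath_listI)
    let ?xs = "[(uA, zB), (uA, uB), (zA, uB), (a, uB), (a, zB), (a, b), (zA, b), (uA, b)]"
    show "distinct ?xs" using ab pts by auto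
    show "set ?xs = A \<times> B - {(zA, zB)}" unfolding A B using ab pts by auto
    show "successively E ?xs" using ab pts EA' EB' by auto
  qed auto
  moreover have "E (uA, b) (uA, zB)" using EA' ab pts by auto
  ultimately show ?thesis unfolding hcycle_def by blast
qed

end

text \<open>\<open>hcycle_of_pair\<close> wants its inverse pair in the second factor. If only the
  first has one, the factors are swapped; the assumptions are symmetric.\<close>

lemma (in two_factors) hcycle_two_factors: "hcycle E (A \<times> B - {(zA, zB)})"
proof (cases "(\<exists>c\<in>B. iB c \<noteq> c) \<or> (\<forall>a\<in>A. iA a = a)")
  case True
  then show ?thesis using hcycle_of_pair hcycle_of_fixed by blast
next
  case False
  then obtain a where a: "a \<in> A" "iA a \<noteq> a" by blast
  interpret flip: two_factors B zB uB iB A zA uA iA "\<lambda>v w. E (prod.swap v) (prod.swap w)"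
    by unfold_locales 
      (simp add: EB, simp add: EA, rule B3, rule A3, (rule fixB; assumption), (rule fixA;
        assumption))
  have "hcycle E (prod.swap ` (B \<times> A - {(zB, zA)}))"
    by (rule hcycle_image[OF flip.hcycle_of_pair[OF a]]) auto
  moreover have "prod.swap ` (B \<times> A - {(zB, zA)}) = A \<times> B - {(zA, zB)}" by auto
  ultimately show ?thesis by simp
qed

section \<open>Finite reduced rings\<close>

locale finite_reduced_ring = cring R for R (structure) +
  assumes finite_carrier: "finite (carrier R)" and one_neq_zero: "\<one> \<noteq> \<zero>"
    and reduced: "x \<in> carrier R \<Longrightarrow> x \<otimes> x = \<zero> \<Longrightarrow> x = \<zero>"
begin

section \<open>Powers and the generalized inverse\<close>

lemma pow_eq_zero:
  assumes "x \<in> carrier R" and "x [^] (n::nat) = \<zero>"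
  shows "x = \<zero>"
  using assms(2)
proof (induction n rule: less_induct)
  case (less n)
  consider "n = 0" | "n = 1" | "n \<ge> 2" by linarith
  then show ?case
  proof cases
    case 1
    then show ?thesis using less.prems one_neq_zero by simp
  next
    case 2
    then show ?thesis using less.prems assms(1) by simp
  next
    case 3
    \<comment> \<open>For n \<ge> 2 the square of the power n - 1 is a multiple of the power n, so
      reducedness lowers the exponent by one.\<close>
    then have "x [^] (n - 1) \<otimes> x [^] (n - 1) = x [^] n \<otimes> x [^] (n - 2)"
      using assms(1) by (simp add: nat_pow_mult numeral_2_eq_2)
    then have "x [^] (n - 1) \<otimes> x [^] (n - 1) = \<zero>" using less.prems assms(1) by simp
    then have "x [^] (n - 1) = \<zero>" using reduced nat_pow_closed[OF assms(1)] by blast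
    then show ?thesis using 3 by (intro less.IH[of "n - 1"]) auto
  qed
qed

text \<open>The powers of the elements repeat with a common period, as there are only finitely many
  maps on the carrier. Reducedness removes the preperiod.\<close>

lemma ex_pow_period: "\<exists>N\<ge>2. \<forall>x\<in>carrier R. x [^] (Suc N) = x"
proof -
  let ?p = "\<lambda>n::nat. restrict (\<lambda>x. x [^] n) (carrier R)"
  have "range ?p \<subseteq> carrier R \<rightarrow>\<^sub>E carrier R" by auto
  then have "finite (range ?p)" using finite_carrier by (meson finite_PiE finite_subset)
  then have "\<not> inj ?p" using finite_imageD infinite_UNIV_nat by blast
  then obtain a' b' where ab': "?p a' = ?p b'" "a' \<noteq> b'" unfolding inj_def by blast
  then have "\<exists>a b. ?p a = ?p b \<and> a < b"
  proof (cases "a' < b'")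
    case False
    then have "?p b' = ?p a' \<and> b' < a'" using ab' by simp
    then show ?thesis by blast
  qed blast
  then obtain a b where ab: "?p a = ?p b" "a < b" by blast
  define d where "d = b - a"
  have d: "d > 0" "b = a + d" using ab(2) by (auto simp: d_def)
  have per: "x [^] (Suc d) = x" if x: "x \<in> carrier R" for x
  proof -
    have eq: "x [^] a = x [^] (a + d)" using fun_cong[OF ab(1), of x] x d by simp
    \<comment> \<open>The power \<open>y [^] Suc a\<close> contains the factor
      \<open>x [^] a \<otimes> (\<one> \<ominus> x [^] d)\<close>, which vanishes. Hence y =
      0.\<close>
    define y where "y = x \<ominus> x [^] (Suc d)"
    have y: "y \<in> carrier R" using x by (simp add: y_def)
    have "x [^] Suc d = x \<otimes> x [^] d" using x by (simp add: m_comm)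
    then have yf: "y = x \<otimes> (\<one> \<ominus> x [^] d)" using x nat_pow_closed[OF x, of d] unfolding y_def
      by algebra
    have "x [^] a \<otimes> (\<one> \<ominus> x [^] d) = x [^] a \<ominus> x [^] (a + d)"
      unfolding nat_pow_mult[OF x, symmetric]
        using nat_pow_closed[OF x, of a] nat_pow_closed[OF x, of d] by algebra
    also have "\<dots> = \<zero>" using eq x by (simp add: a_minus_def r_neg)
    finally have z: "x [^] a \<otimes> (\<one> \<ominus> x [^] d) = \<zero>" .
    have "y [^] Suc a = x \<otimes> (x [^] a \<otimes> (\<one> \<ominus> x [^] d)) \<otimes> (\<one> \<ominus> x [^] d) [^] a"
    proof -
      have w: "\<one> \<ominus> x [^] d \<in> carrier R" using x by simp
      have "y [^] Suc a = (x [^] a \<otimes> (\<one> \<ominus> x [^] d) [^] a) \<otimes> (x \<otimes> (\<one> \<ominus> x [^] d))"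
        unfolding yf using x w by (simp add: nat_pow_distrib)
      then show ?thesis using x w nat_pow_closed[OF x, of a] nat_pow_closed[OF w, of a] by algebra
    qed
    also have "\<dots> = \<zero>" using x z by simp
    finally have "y = \<zero>" by (rule pow_eq_zero[OF y])
    then show ?thesis using x unfolding y_def by (metis nat_pow_closed r_right_minus_eq)
  qed
  \<comment> \<open>Doubling makes the period at least 2. The exponent of the generalized inverse,
    one less, is then positive, so that 0 is mapped to 0 and corners are preserved.\<close>
  have "x [^] Suc (2 * d) = x" if x: "x \<in> carrier R" for x
  proof -
    have "x [^] Suc (2 * d) = x [^] (Suc d) \<otimes> x [^] d" using x nat_pow_mult[of x "Suc d" d]
      by (simp add: mult_2)
    also have "\<dots> = x \<otimes> x [^] d" using per[OF x] by simp
    also have "\<dots> = x [^] Suc d" using x by (simp add: m_comm)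
    finally show ?thesis using per[OF x] by simp
  qed
  then show ?thesis using d by (intro exI[of _ "2 * d"]) auto
qed

definition period :: nat where "period = (SOME N. N \<ge> 2 \<and> (\<forall>x\<in>carrier R. x [^] (Suc N) = x))"

lemma period: "period \<ge> 2" "x \<in> carrier R \<Longrightarrow> x [^] (Suc period) = x"
  using someI_ex[OF ex_pow_period[unfolded Bex_def]] unfolding period_def by auto

definition qinv :: "'a \<Rightarrow> 'a" where "qinv x = x [^] (period - 1)"

lemma qinv_closed [simp]: "x \<in> carrier R \<Longrightarrow> qinv x \<in> carrier R"
  by (simp add: qinv_def)

lemma qinv_regular:
  assumes "x \<in> carrier R" shows "x \<otimes> x \<otimes> qinv x = x"
proof -
  have "x \<otimes> x = x [^] (2::nat)" using assms by (simp add: numeral_2_eq_2)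
  then have "x \<otimes> x \<otimes> qinv x = x [^] (2 + (period - 1))"
    using assms by (simp add: qinv_def nat_pow_mult)
  also have "2 + (period - 1) = Suc period" using period(1) by simp
  finally show ?thesis using period(2)[OF assms] by simp
qed

text \<open>With N the period, the exponent is (N - 1)^2 = (N - 2) N + 1, which is 1 modulo
  N.\<close>

lemma qinv_qinv:
  assumes "x \<in> carrier R" shows "qinv (qinv x) = x"
proof -
  have *: "x [^] (k * period + 1) = x" for k
  proof (induction k)
    case (Suc k)
    have eq: "Suc k * period + 1 = (k * period + 1) + period" by simp
    have "x [^] (Suc k * period + 1) = x [^] (k * period + 1) \<otimes> x [^] period"
      unfolding eq using assms by (simp only: nat_pow_mult)
    also have "\<dots> = x [^] Suc period" unfolding Suc using assms by (simp add: m_comm)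
    finally show ?case using period(2)[OF assms] by simp
  qed (use assms in simp)
  obtain k where k: "period = Suc (Suc k)" using period(1) by (intro that[of "period - 2"]) simp
  have "(period - 1) * (period - 1) = k * period + 1" unfolding k by simp
  then show ?thesis using assms *[of k] by (simp add: qinv_def nat_pow_pow)
qed

lemma qinv_idem:
  assumes "e \<in> carrier R" and "e \<otimes> e = e"
  shows "qinv e = e"
proof -
  have "e [^] Suc k = e" for k by (induction k) (use assms in simp_all)
  moreover obtain k where "period - 1 = Suc k" using period(1) by (intro that[of "period - 2"]) simp
  ultimately show ?thesis by (simp add: qinv_def)
qed

lemma qinv_corner:
  assumes "e \<in> carrier R" and "x \<in> carrier R" and "e \<otimes> x = x"
  shows "e \<otimes> qinv x = qinv x"
proof -
  obtain k where "period - 1 = Suc k" using period(1) by (intro that[of "period - 2"]) simp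
  then have "qinv x = x \<otimes> x [^] k" using assms by (simp add: qinv_def m_comm)
  then show ?thesis using assms by (simp add: m_assoc [symmetric])
qed

text \<open>Such a \<open>g\<close> annihilates \<open>\<one> \<ominus> x \<otimes> y\<close>, which
  is then no unit. In this form adjacency can be verified within a single corner.\<close>

definition adj :: "'a \<Rightarrow> 'a \<Rightarrow> bool" where
  "adj x y \<longleftrightarrow> (\<exists>g\<in>carrier R. g \<noteq> \<zero> \<and> g \<otimes> (x \<otimes> y) = g)"

definition idem :: "'a \<Rightarrow> bool" where "idem e \<longleftrightarrow> e \<in> carrier R \<and> e \<otimes> e = e"

lemma idemD: "idem e \<Longrightarrow> e \<in> carrier R" "idem e \<Longrightarrow> e \<otimes> e = e"
  by (simp_all add: idem_def)

lemma idem_qinv: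
  assumes "x \<in> carrier R" shows "idem (x \<otimes> qinv x)" and "x \<otimes> qinv x = \<zero> \<longleftrightarrow> x = \<zero>"
proof -
  have "(x \<otimes> qinv x) \<otimes> (x \<otimes> qinv x) = (x \<otimes> x \<otimes> qinv x) \<otimes> qinv x"
    using assms qinv_closed[OF assms] by algebra
  then show "idem (x \<otimes> qinv x)" using assms qinv_regular by (simp add: idem_def)
  have "x = \<zero>" if "x \<otimes> qinv x = \<zero>"
  proof -
    have "x = x \<otimes> (x \<otimes> qinv x)" using qinv_regular[OF assms] assms by (simp add: m_assoc)
    then show ?thesis using that assms by simp
  qed
  then show "x \<otimes> qinv x = \<zero> \<longleftrightarrow> x = \<zero>" using assms by auto
qed

text \<open>The product of e v and its generalized inverse is a nonzero idempotent in the corner of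
  e, and it serves as the witness for \<open>adj\<close>.\<close>

lemma adj_corner:
  assumes e: "idem e" and v: "v \<in> carrier R" and w: "w \<in> carrier R"
    and "e \<otimes> v \<noteq> \<zero>" and ew: "e \<otimes> w = qinv (e \<otimes> v)"
  shows "adj v w"
proof -
  define x where "x = e \<otimes> v"
  have c: "e \<in> carrier R" "x \<in> carrier R" "qinv x \<in> carrier R" using idemD[OF e] v
    by (simp_all add: x_def)
  let ?g = "x \<otimes> qinv x"
  have ex: "e \<otimes> x = x" using e v c unfolding x_def by (simp add: m_assoc [symmetric] idemD)
  have "?g \<otimes> (v \<otimes> w) = (e \<otimes> x) \<otimes> (e \<otimes> qinv x) \<otimes> (v \<otimes> w)"
    using ex qinv_corner[OF c(1,2) ex] by simp
  also have "\<dots> = ?g \<otimes> ((e \<otimes> v) \<otimes> (e \<otimes> w))" using c v w by algebra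
  also have "\<dots> = ?g \<otimes> ?g" using ew by (simp add: x_def)
  also have "\<dots> = ?g" using idem_qinv(1)[OF c(2)] idemD by blast
  finally have "?g \<otimes> (v \<otimes> w) = ?g" .
  moreover have "?g \<noteq> \<zero>" using idem_qinv(2)[OF c(2)] assms(4) by (simp add: x_def)
  ultimately show ?thesis using c unfolding adj_def by (intro bexI[of _ ?g]) auto
qed

section \<open>Corners of idempotents\<close>

definition corner :: "'a \<Rightarrow> 'a set" where "corner e = {x \<in> carrier R. e \<otimes> x = x}"

lemma corner_subset: "corner e \<subseteq> carrier R" by (auto simp: corner_def)

lemma pointed_involution_corner:
  assumes "idem e" and "e \<noteq> \<zero>"
  shows "pointed_involution (corner e) \<zero> e qinv"
proof
  show "finite (corner e)" using finite_carrier corner_subset finite_subset by blast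
  show "qinv \<zero> = \<zero>" by (rule qinv_idem) auto
  show "qinv c \<in> corner e" if "c \<in> corner e" for c
    using that qinv_corner assms by (auto simp: corner_def idem_def)
qed (use assms in \<open>auto simp: corner_def idem_def qinv_idem qinv_qinv\<close>)

lemma corner_orth:
  assumes "idem e" and "idem f" and "e \<otimes> f = \<zero>" and "x \<in> corner f"
  shows "e \<otimes> x = \<zero>"
proof -
  have "e \<otimes> x = e \<otimes> (f \<otimes> x)" using assms(4) by (simp add: corner_def)
  also have "\<dots> = (e \<otimes> f) \<otimes> x" 
    by (rule m_assoc[symmetric]) (use assms in \<open>auto simp: corner_def idem_def\<close>)
  finally show ?thesis using assms by (simp add: corner_def)
qed

lemma idem_compl:
  assumes "idem e"
  shows "idem (\<one> \<ominus> e)" and "e \<otimes> (\<one> \<ominus> e) = \<zero>" and "(\<one> \<ominus> e) \<otimes> e = \<zero>" and "e \<oplus> (\<one> \<ominus> e) = \<one>"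
proof -
  note e = idemD[OF assms]
  show z: "e \<otimes> (\<one> \<ominus> e) = \<zero>"
  proof -
    have "e \<otimes> (\<one> \<ominus> e) = e \<ominus> e \<otimes> e" using e(1) by algebra
    then show ?thesis using e by (simp add: a_minus_def r_neg)
  qed
  then show "(\<one> \<ominus> e) \<otimes> e = \<zero>" using e by (simp add: m_comm)
  show "e \<oplus> (\<one> \<ominus> e) = \<one>" using e(1) by algebra
  have "(\<one> \<ominus> e) \<otimes> (\<one> \<ominus> e) = (\<one> \<ominus> e) \<ominus> e \<otimes> (\<one> \<ominus> e)" using e(1) by algebra
  then show "idem (\<one> \<ominus> e)" using z e by (simp add: idem_def a_minus_def)
qed

text \<open>This is the Peirce decomposition: the corner of an idempotent e is the ideal e R, and
  the inverse map sends x to (e x, f x).\<close>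

lemma bij_betw_corners:
  assumes e: "idem e" and f: "idem f" and ef: "e \<otimes> f = \<zero>"
  shows "bij_betw (\<lambda>(a, b). a \<oplus> b) (corner e \<times> corner f) (corner (e \<oplus> f))"
    and "a \<in> corner e \<Longrightarrow> b \<in> corner f \<Longrightarrow> e \<otimes> (a \<oplus> b) = a"
    and "a \<in> corner e \<Longrightarrow> b \<in> corner f \<Longrightarrow> f \<otimes> (a \<oplus> b) = b"
proof -
  have fe: "f \<otimes> e = \<zero>" using ef e f by (simp add: idem_def m_comm)
  show pe: "e \<otimes> (a \<oplus> b) = a" if "a \<in> corner e" "b \<in> corner f" for a b
    using that corner_orth[OF e f ef that(2)] e by (simp add: corner_def idem_def r_distr)
  show pf: "f \<otimes> (a \<oplus> b) = b" if "a \<in> corner e" "b \<in> corner f" for a b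
    using that corner_orth[OF f e fe that(1)] f by (simp add: corner_def idem_def r_distr)
  show "bij_betw (\<lambda>(a, b). a \<oplus> b) (corner e \<times> corner f) (corner (e \<oplus> f))"
  proof (rule bij_betw_byWitness[where f' = "\<lambda>x. (e \<otimes> x, f \<otimes> x)"])
    show "\<forall>v\<in>corner e \<times> corner f. (e \<otimes> (case v of (a, b) \<Rightarrow> a \<oplus> b), f \<otimes> (case v of (a, b) \<Rightarrow> a \<oplus> b)) =
        v"
      using pe pf by auto
    show "\<forall>x\<in>corner (e \<oplus> f). (case (e \<otimes> x, f \<otimes> x) of (a, b) \<Rightarrow> a \<oplus> b) = x"
      using e f by (auto simp: corner_def idem_def l_distr)
    show "(\<lambda>x. (e \<otimes> x, f \<otimes> x)) ` corner (e \<oplus> f) \<subseteq> corner e \<times> corner f"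
      using e f by (auto simp: corner_def idem_def m_assoc [symmetric])
    show "(\<lambda>(a, b). a \<oplus> b) ` (corner e \<times> corner f) \<subseteq> corner (e \<oplus> f)"
    proof clarify
      fix a b assume ab: "a \<in> corner e" "b \<in> corner f"
      then have "(e \<oplus> f) \<otimes> (a \<oplus> b) = e \<otimes> (a \<oplus> b) \<oplus> f \<otimes> (a \<oplus> b)"
        using e f by (simp add: corner_def idem_def l_distr)
      then show "a \<oplus> b \<in> corner (e \<oplus> f)" using ab pe pf by (simp add: corner_def)
    qed
  qed
qed

lemma corner_one [simp]: "corner \<one> = carrier R"
  by (auto simp: corner_def)

lemma zero_in_corner: "idem e \<Longrightarrow> \<zero> \<in> corner e"
  by (simp add: corner_def idem_def)

definition primitive :: "'a \<Rightarrow> bool" where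
  "primitive e \<longleftrightarrow> idem e \<and> e \<noteq> \<zero> \<and> (\<forall>g\<in>corner e. idem g \<longrightarrow> g = \<zero> \<or> g = e)"

text \<open>The product is a nonzero idempotent of the corner, and primitivity leaves only e. So the
  corner is a field and \<open>qinv\<close> its inversion.\<close>

lemma primitive_inverse:
  assumes "primitive e" and "x \<in> corner e" and "x \<noteq> \<zero>"
  shows "x \<otimes> qinv x = e"
proof -
  have x: "x \<in> carrier R" "e \<otimes> x = x" "e \<in> carrier R" using assms
    by (auto simp: corner_def primitive_def idem_def)
  then have "x \<otimes> qinv x \<in> corner e" by (simp add: corner_def m_assoc [symmetric])
  then show ?thesis using assms idem_qinv[OF x(1)] unfolding primitive_def by blast
qed

text \<open>From a a = e follows (a + e) (a - e) = 0, and a - e is invertible in the corner. This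
  yields \<open>fixA\<close>, \<open>fixB\<close> and \<open>fix1\<close>.\<close>

lemma primitive_fixed:
  assumes e: "primitive e" and a: "a \<in> corner e - {\<zero>, e}" and qa: "qinv a = a"
  shows "a = \<ominus> e"
proof -
  have c: "a \<in> carrier R" "e \<otimes> a = a" "e \<in> carrier R" "e \<otimes> e = e"
    using e a by (auto simp: corner_def primitive_def idem_def)
  have aa: "a \<otimes> a = e" using primitive_inverse[OF e, of a] a qa by auto
  have "a \<ominus> e \<in> corner e"
    using c by (simp add: corner_def r_distr a_minus_def r_minus)
  moreover have "a \<ominus> e \<noteq> \<zero>" using a r_right_minus_eq[OF c(1,3)] by simp
  ultimately have u: "(a \<ominus> e) \<otimes> qinv (a \<ominus> e) = e" using primitive_inverse[OF e] by blast
  have "(a \<oplus> e) \<otimes> (a \<ominus> e) = a \<otimes> a \<ominus> e \<otimes> e" using c(1,3) by algebra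
  then have z: "(a \<oplus> e) \<otimes> (a \<ominus> e) = \<zero>" using aa c by (simp add: a_minus_def r_neg)
  have "a \<oplus> e = (a \<oplus> e) \<otimes> e" using c by (simp add: l_distr m_comm[of a e])
  also have "\<dots> = ((a \<oplus> e) \<otimes> (a \<ominus> e)) \<otimes> qinv (a \<ominus> e)"
    using u c by (simp add: m_assoc)
  also have "\<dots> = \<zero>" using z c by simp
  finally show ?thesis using c by (metis minus_equality)
qed

end

section \<open>Cycles and paths in the reduced ring\<close>

context finite_reduced_ring
begin

text \<open>The identity is the sum of the orthogonal nonzero idempotents g, e - g and 1 - e, whose
  corners are the three factors.\<close>

lemma hcycle_non_primitive:
  assumes e: "idem e" "e \<noteq> \<one>" and g: "idem g" "g \<in> corner e" "g \<noteq> \<zero>" "g \<noteq> e"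
  shows "hcycle adj (carrier R - {\<zero>})"
proof -
  let ?f = "\<one> \<ominus> e" and ?h = "e \<ominus> g"
  have c: "e \<in> carrier R" "g \<in> carrier R" "e \<otimes> e = e" "g \<otimes> g = g" "e \<otimes> g = g"
    using e g by (auto simp: idem_def corner_def)
  have f: "idem ?f" and ef: "e \<otimes> ?f = \<zero>" and ef1: "e \<oplus> ?f = \<one>" using idem_compl[OF e(1)] by auto
  have f0: "?f \<noteq> \<zero>" using e c by auto
  have "?h \<otimes> ?h = e \<otimes> e \<ominus> e \<otimes> g \<ominus> e \<otimes> g \<oplus> g \<otimes> g" using c(1,2) by algebra
  also have "\<dots> = ?h" unfolding c using c(1,2) by algebra
  finally have h: "idem ?h" using c by (simp add: idem_def)
  have h0: "?h \<noteq> \<zero>" using c g by auto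
  have "g \<otimes> ?h = e \<otimes> g \<ominus> g \<otimes> g" using c(1,2) by algebra
  also have "\<dots> = \<zero>" unfolding c using c(2) by algebra
  finally have gh: "g \<otimes> ?h = \<zero>" .
  have ghe: "g \<oplus> ?h = e" using c(1,2) by algebra
  have ch: "?h \<in> carrier R" "?f \<in> carrier R" "g \<in> carrier R" using c by simp_all
  have ge: "g \<otimes> e = g" using c by (simp add: m_comm)
  have he: "?h \<otimes> e = ?h"
  proof -
    have "?h \<otimes> e = e \<otimes> e \<ominus> e \<otimes> g" using c(1,2) by algebra
    then show ?thesis using c by simp
  qed
  define mk where "mk = (\<lambda>((x, y), z). (x \<oplus> y) \<oplus> z)"
  let ?V = "(corner g \<times> corner ?h) \<times> corner ?f"
  note bij1 = bij_betw_corners[OF g(1) h gh, unfolded ghe]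
  note bij2 = bij_betw_corners[OF e(1) f ef, unfolded ef1 corner_one]
  have bij: "bij_betw mk ?V (carrier R)"
  proof -
    have "bij_betw (map_prod (\<lambda>(a, b). a \<oplus> b) id) ?V (corner e \<times> corner ?f)"
      using bij1(1) bij_betw_id by (rule bij_betw_map_prod)
    from bij_betw_trans[OF this bij2(1)] show ?thesis
      by (rule bij_betw_cong[THEN iffD1, rotated]) (auto simp: mk_def)
  qed
  have e_mk: "e \<otimes> mk ((x, y), z) = x \<oplus> y" "?f \<otimes> mk ((x, y), z) = z" if "((x, y), z) \<in> ?V" for x y z
  proof -
    have "x \<oplus> y \<in> corner e" using bij_betwE[OF bij1(1)] that by auto
    then show "e \<otimes> mk ((x, y), z) = x \<oplus> y" "?f \<otimes> mk ((x, y), z) = z"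
      using bij2(2,3)[of "x \<oplus> y" z] that by (auto simp: mk_def)
  qed
  have mk_closed: "mk v \<in> carrier R" if "v \<in> ?V" for v using bij_betwE[OF bij] that by auto
  have coord: "g \<otimes> mk ((x, y), z) = x" "?h \<otimes> mk ((x, y), z) = y" if v: "((x, y), z) \<in> ?V" for x y z
  proof -
    have "g \<otimes> mk ((x, y), z) = g \<otimes> (e \<otimes> mk ((x, y), z))" "?h \<otimes> mk ((x, y), z) = ?h \<otimes> (e \<otimes> mk ((x,
        y), z))"
      using ge he mk_closed[OF v] c(1) ch by (simp_all add: m_assoc [symmetric])
    then show "g \<otimes> mk ((x, y), z) = x" "?h \<otimes> mk ((x, y), z) = y"
      unfolding e_mk[OF v] using bij1(2,3)[of x y] v by auto
  qed
  interpret P: pointed_involution "corner g" \<zero> g qinv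
    by (rule pointed_involution_corner) (use g in auto)
  interpret Q: pointed_involution "corner ?h" \<zero> ?h qinv
    by (rule pointed_involution_corner) (use h h0 in auto)
  interpret C: pointed_involution "corner ?f" \<zero> ?f qinv
    by (rule pointed_involution_corner) (use f f0 in auto)
  have "hcycle (\<lambda>v w. adj (mk v) (mk w)) (?V - {((\<zero>, \<zero>), \<zero>)})"
  proof (rule hcycle_three_factors[OF P.pointed_involution_axioms Q.pointed_involution_axioms
    C.pointed_involution_axioms])
    fix x y y' z z' assume *: "x \<in> corner g - {\<zero>}" "y \<in> corner ?h" "y' \<in> corner ?h" "z \<in> corner ?f"
      "z' \<in> corner ?f"
    then have v: "((x, y), z) \<in> ?V" "((qinv x, y'), z') \<in> ?V" using P.inv_closed by auto
    show "adj (mk ((x, y), z)) (mk ((qinv x, y'), z'))"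
      by (rule adj_corner[OF g(1) mk_closed[OF v(1)] mk_closed[OF v(2)]]) (use coord[OF v(1)]
        coord[OF v(2)] * in auto)
  next
    fix x x' y z z' assume *: "x \<in> corner g" "x' \<in> corner g" "y \<in> corner ?h - {\<zero>}" "z \<in> corner ?f"
      "z' \<in> corner ?f"
    then have v: "((x, y), z) \<in> ?V" "((x', qinv y), z') \<in> ?V" using Q.inv_closed by auto
    show "adj (mk ((x, y), z)) (mk ((x', qinv y), z'))"
      by (rule adj_corner[OF h mk_closed[OF v(1)] mk_closed[OF v(2)]]) (use coord[OF v(1)] coord[OF
        v(2)] * in auto)
  next
    fix x x' y y' z assume *: "x \<in> corner g" "x' \<in> corner g" "y \<in> corner ?h" "y' \<in> corner ?h" "z \<in>
        corner ?f - {\<zero>}"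
    then have v: "((x, y), z) \<in> ?V" "((x', y'), qinv z) \<in> ?V" using C.inv_closed by auto
    show "adj (mk ((x, y), z)) (mk ((x', y'), qinv z))"
      by (rule adj_corner[OF f mk_closed[OF v(1)] mk_closed[OF v(2)]]) (use e_mk[OF v(1)] e_mk[OF
        v(2)] * in auto)
  qed
  then have "hcycle adj (mk ` (?V - {((\<zero>, \<zero>), \<zero>)}))"
    by (rule hcycle_image) (use bij in \<open>auto simp: bij_betw_def intro: inj_on_subset\<close>)
  moreover have "mk ` (?V - {((\<zero>, \<zero>), \<zero>)}) = carrier R - {\<zero>}"
  proof -
    have "mk ` (?V - {((\<zero>, \<zero>), \<zero>)}) = mk ` ?V - mk ` {((\<zero>, \<zero>), \<zero>)}"
      by (rule inj_on_image_set_diff[OF bij_betw_imp_inj_on[OF bij]]) (use P.z Q.z C.z in auto)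
    then show ?thesis using bij_betw_imp_surj_on[OF bij] by (simp add: mk_def)
  qed
  ultimately show ?thesis by simp
qed

lemma adj_two_corners:
  assumes e: "idem e" and f: "idem f" and ef: "e \<otimes> f = \<zero>"
    and a: "a \<in> corner e - {\<zero>}" and b: "b \<in> corner f" "b' \<in> corner f"
  shows "adj (a \<oplus> b) (qinv a \<oplus> b')" and "adj (b \<oplus> a) (b' \<oplus> qinv a)"
proof -
  have qa: "qinv a \<in> corner e" using a qinv_corner e by (auto simp: corner_def idem_def)
  have c: "a \<in> carrier R" "qinv a \<in> carrier R" "b \<in> carrier R" "b' \<in> carrier R"
    using a b qa corner_subset by auto
  show *: "adj (a \<oplus> b) (qinv a \<oplus> b')"
    by (rule adj_corner[OF e])
       (use bij_betw_corners(2)[OF e f ef, of a b] bij_betw_corners(2)[OF e f ef qa b(2)] a b c in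
         auto)
  then show "adj (b \<oplus> a) (b' \<oplus> qinv a)" using c by (simp add: a_comm)
qed

lemma image_two_corners:
  assumes e: "idem e"
  defines "f \<equiv> \<one> \<ominus> e"
  shows "inj_on (\<lambda>(a, b). a \<oplus> b) (corner e \<times> corner f)"
    and "(\<lambda>(a, b). a \<oplus> b) ` (corner e \<times> corner f - {(\<zero>, \<zero>)}) = carrier R - {\<zero>}"
proof -
  note f = idem_compl[OF e, folded f_def]
  have bij: "bij_betw (\<lambda>(a, b). a \<oplus> b) (corner e \<times> corner f) (carrier R)"
    using bij_betw_corners(1)[OF e f(1,2)] f(4) by simp
  then show inj: "inj_on (\<lambda>(a, b). a \<oplus> b) (corner e \<times> corner f)" by (rule bij_betw_imp_inj_on)
  have "(\<lambda>(a, b). a \<oplus> b) ` (corner e \<times> corner f - {(\<zero>, \<zero>)})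
    = (\<lambda>(a, b). a \<oplus> b) ` (corner e \<times> corner f) - (\<lambda>(a, b). a \<oplus> b) ` {(\<zero>, \<zero>)}"
    by (rule inj_on_image_set_diff[OF inj]) (use zero_in_corner e f(1) in auto)
  then show "(\<lambda>(a, b). a \<oplus> b) ` (corner e \<times> corner f - {(\<zero>, \<zero>)}) = carrier R - {\<zero>}"
    using bij_betw_imp_surj_on[OF bij] by simp
qed

lemma hcycle_two_fields:
  assumes e: "primitive e" and f: "primitive (\<one> \<ominus> e)"
    and "corner e - {\<zero>, e} \<noteq> {}" and "corner (\<one> \<ominus> e) - {\<zero>, \<one> \<ominus> e} \<noteq> {}"
  shows "hcycle adj (carrier R - {\<zero>})"
proof -
  let ?f = "\<one> \<ominus> e"
  have ie: "idem e" "e \<noteq> \<zero>" and jf: "idem ?f" "?f \<noteq> \<zero>" using e f by (auto simp: primitive_def)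
  note ef = idem_compl(2,3)[OF ie(1)]
  interpret A: pointed_involution "corner e" \<zero> e qinv by (rule pointed_involution_corner[OF ie])
  interpret B: pointed_involution "corner ?f" \<zero> ?f qinv by (rule pointed_involution_corner[OF jf])
  interpret two_factors "corner e" \<zero> e qinv "corner ?f" \<zero> ?f qinv "\<lambda>(a, b) (a', b'). adj (a \<oplus> b) (a'
      \<oplus> b')"
  proof
    show "a = a'" if "a \<in> corner e - {\<zero>, e}" "a' \<in> corner e - {\<zero>, e}" "qinv a = a" "qinv a' = a'"
      for a a'
      using primitive_fixed[OF e that(1,3)] primitive_fixed[OF e that(2,4)] by simp
    show "b = b'" if "b \<in> corner ?f - {\<zero>, ?f}" "b' \<in> corner ?f - {\<zero>, ?f}" "qinv b = b" "qinv b' =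
        b'" for b b'
      using primitive_fixed[OF f that(1,3)] primitive_fixed[OF f that(2,4)] by simp
  qed (use adj_two_corners(1)[OF ie(1) jf(1) ef(1)] adj_two_corners(2)[OF jf(1) ie(1) ef(2)]
    assms(3,4) in auto)
  have "hcycle adj ((\<lambda>(a, b). a \<oplus> b) ` (corner e \<times> corner ?f - {(\<zero>, \<zero>)}))"
    by (rule hcycle_image[OF hcycle_two_factors inj_on_subset[OF image_two_corners(1)[OF ie(1)]]])
      auto
  then show ?thesis unfolding image_two_corners(2)[OF ie(1)] .
qed

text \<open>The copy index is attached to the first coordinate. The row of e becomes
  \<open>m\<close> rows, and two of them supply the ends in \<open>hcycle_columns\<close>.\<close>

lemma hcycle_thick:
  fixes m :: nat
  assumes ie: "idem e" "e \<noteq> \<zero>" "e \<noteq> \<one>" and "corner e = {\<zero>, e}" and "2 \<le> m"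
  shows "hcycle (\<lambda>(x, j) (y, k). adj x y) ((carrier R - {\<zero>}) \<times> {..<m})"
proof -
  let ?f = "\<one> \<ominus> e"
  note jf = idem_compl[OF ie(1)]
  have f0: "?f \<noteq> \<zero>" using ie by (auto simp: idem_def)
  interpret B: pointed_involution "corner ?f" \<zero> ?f qinv
    by (rule pointed_involution_corner[OF jf(1) f0])
  let ?E = "\<lambda>((a, j), b) ((a', k), b'). adj (a \<oplus> b) (a' \<oplus> b')"
  let ?D = "corner e \<times> {..<m}" and ?D' = "{e} \<times> {..<m}"
  have e: "e \<in> corner e" "\<zero> \<in> corner e" using assms(4) by auto
  have "hcycle ?E (?D \<times> (corner ?f - {\<zero>}) \<union> ?D' \<times> {\<zero>})"
  proof (rule B.hcycle_columns[where k = "(e, 0)" and k' = "(e, 1)"])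
    show "?E (d, c) (d', qinv c)" if "c \<in> corner ?f - {\<zero>}" "d \<in> ?D" "d' \<in> ?D" for c d d'
      using adj_two_corners(2)[OF jf(1) ie(1) jf(3)] that by auto
    have qe: "qinv e = e" using ie by (auto simp: idem_def qinv_idem)
    show "?E (d, c) (d', c')" if "d \<in> ?D'" "d' \<in> ?D'" "c \<in> corner ?f" "c' \<in> corner ?f" for c c' d d'
      using adj_two_corners(1)[OF ie(1) jf(1) jf(2), of e c c'] that e qe ie(2) by auto
  qed (use assms(4,5) e in auto)
  then have "hcycle (\<lambda>(x, j) (y, k). adj x y) ((\<lambda>((a, j), b). (a \<oplus> b, j)) ` (?D \<times> (corner ?f - {\<zero>})
      \<union> ?D' \<times> {\<zero>}))"
  proof (rule hcycle_image)
    show "inj_on (\<lambda>((a, j), b). (a \<oplus> b, j)) (?D \<times> (corner ?f - {\<zero>}) \<union> ?D' \<times> {\<zero>})"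
    proof (rule inj_onI)
      fix v v' :: "('a \<times> nat) \<times> 'a"
      obtain a j b a' j' b' where v: "v = ((a, j), b)" "v' = ((a', j'), b')" by (metis surj_pair)
      assume 1: "v \<in> ?D \<times> (corner ?f - {\<zero>}) \<union> ?D' \<times> {\<zero>}"
        and 2: "v' \<in> ?D \<times> (corner ?f - {\<zero>}) \<union> ?D' \<times> {\<zero>}"
        and eq: "(\<lambda>((a, j), b). (a \<oplus> b, j)) v = (\<lambda>((a, j), b). (a \<oplus> b, j)) v'"
      have "(a, b) \<in> corner e \<times> corner ?f" "(a', b') \<in> corner e \<times> corner ?f" using 1 2 v e B.z
        by auto
      then have "(a, b) = (a', b')"
        using inj_onD[OF image_two_corners(1)[OF ie(1)], of "(a, b)" "(a', b')"] eq v by simp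
      then show "v = v'" using eq v by simp
    qed
  qed auto
  moreover have "(\<lambda>((a, j), b). (a \<oplus> b, j)) ` (?D \<times> (corner ?f - {\<zero>}) \<union> ?D' \<times> {\<zero>}) = (carrier R -
      {\<zero>}) \<times> {..<m}"
  proof -
    have "(\<lambda>((a, j), b). (a \<oplus> b, j)) ` (?D \<times> (corner ?f - {\<zero>}) \<union> ?D' \<times> {\<zero>})
      = (\<lambda>(a, b). a \<oplus> b) ` (corner e \<times> corner ?f - {(\<zero>, \<zero>)}) \<times> {..<m}"
    proof (intro equalityI subsetI)
      fix v assume "v \<in> (\<lambda>(a, b). a \<oplus> b) ` (corner e \<times> corner ?f - {(\<zero>, \<zero>)}) \<times> {..<m}"
      then obtain a b j where v: "v = (a \<oplus> b, j)" "a \<in> corner e" "b \<in> corner ?f" "(a, b) \<noteq> (\<zero>, \<zero>)"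
        "j < m" by auto
      then have "((a, j), b) \<in> ?D \<times> (corner ?f - {\<zero>}) \<union> ?D' \<times> {\<zero>}" using assms(4) by auto
      then show "v \<in> (\<lambda>((a, j), b). (a \<oplus> b, j)) ` (?D \<times> (corner ?f - {\<zero>}) \<union> ?D' \<times> {\<zero>})"
        by (rule image_eqI[rotated]) (simp add: v(1))
    next
      fix v assume "v \<in> (\<lambda>((a, j), b). (a \<oplus> b, j)) ` (?D \<times> (corner ?f - {\<zero>}) \<union> ?D' \<times> {\<zero>})"
      then obtain a b j where v: "v = (a \<oplus> b, j)" "((a, j), b) \<in> ?D \<times> (corner ?f - {\<zero>}) \<union> ?D' \<times> {\<zero>}"
        by auto
      then have j: "j < m" and "(a, b) \<in> corner e \<times> corner ?f - {(\<zero>, \<zero>)}" using e B.z ie(2) by auto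
      from this(2) have "a \<oplus> b \<in> (\<lambda>(a, b). a \<oplus> b) ` (corner e \<times> corner ?f - {(\<zero>, \<zero>)})"
        by (rule image_eqI[rotated]) simp
      then show "v \<in> (\<lambda>(a, b). a \<oplus> b) ` (corner e \<times> corner ?f - {(\<zero>, \<zero>)}) \<times> {..<m}"
        using j by (simp add: v(1))
    qed
    then show ?thesis unfolding image_two_corners(2)[OF ie(1)] .
  qed
  ultimately show ?thesis by simp
qed

text \<open>The internal form of R \<cong> \<int>_2 \<oplus> F, with e in the role of (1,
  0).\<close>

definition Z2_field_idem :: "'a \<Rightarrow> bool" where
  "Z2_field_idem e \<longleftrightarrow> idem e \<and> e \<noteq> \<zero> \<and> corner e = {\<zero>, e} \<and> primitive (\<one> \<ominus> e)"

text \<open>In the application \<open>m\<close> is the size of the radical. If e or 1 - e is not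
  primitive, there are three factors. Otherwise both corners are fields, and if one has two
  elements, then \<open>exc\<close> forces at least two copies.\<close>

lemma hcycle_blow_up_adj:
  fixes m :: nat
  assumes e: "idem e" "e \<noteq> \<zero>" "e \<noteq> \<one>" and m: "0 < m" and exc: "m = 1 \<Longrightarrow> \<nexists>e. Z2_field_idem e"
  shows "hcycle (\<lambda>(x, j) (y, k). adj x y) ((carrier R - {\<zero>}) \<times> {..<m})"
proof -
  let ?f = "\<one> \<ominus> e"
  have c: "e \<in> carrier R" using e by (simp add: idem_def)
  have f: "idem ?f" "?f \<noteq> \<zero>" "?f \<noteq> \<one>" "\<one> \<ominus> ?f = e"
  proof -
    show "idem ?f" "?f \<noteq> \<zero>" using idem_compl[OF e(1)] e c by auto
    show ff: "\<one> \<ominus> ?f = e" using c by algebra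
    then show "?f \<noteq> \<one>" using e(2) c by auto
  qed
  show ?thesis
  proof (cases "primitive e \<and> primitive ?f")
    case False
    then have "hcycle adj (carrier R - {\<zero>})"
      using hcycle_non_primitive[OF e(1,3)] hcycle_non_primitive[OF f(1,3)] e(1,2) f(1,2)
      unfolding primitive_def by blast
    then show ?thesis using m by (rule hcycle_blow_up)
  next
    case True
    show ?thesis
    proof (cases "corner e = {\<zero>, e} \<or> corner ?f = {\<zero>, ?f}")
      case c2: True
      then have "Z2_field_idem e \<or> Z2_field_idem ?f"
        using True e f unfolding Z2_field_idem_def by auto
      then have "2 \<le> m" using exc m by (metis One_nat_def Suc_leI Suc_1 le_neq_implies_less)
      then show ?thesis using c2 hcycle_thick[OF e] hcycle_thick[OF f(1-3)] by blast
    next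
      case c3: False
      have "corner e - {\<zero>, e} \<noteq> {}" "corner ?f - {\<zero>, ?f} \<noteq> {}"
        using c3 zero_in_corner e(1) f(1) unfolding corner_def idem_def by blast+
      then have "hcycle adj (carrier R - {\<zero>})" using hcycle_two_fields True by blast
      then show ?thesis using m by (rule hcycle_blow_up)
    qed
  qed
qed

lemma hpath_Z2_field:
  assumes "Z2_field_idem e"
  shows "\<exists>v w. hpath adj (carrier R - {\<zero>}) v w"
proof -
  let ?f = "\<one> \<ominus> e"
  have e: "idem e" "e \<noteq> \<zero>" "corner e = {\<zero>, e}" and f: "primitive ?f" using assms
    by (auto simp: Z2_field_idem_def)
  then have f': "idem ?f" "?f \<noteq> \<zero>" by (auto simp: primitive_def)
  note ef = idem_compl(2,3)[OF e(1)]
  interpret B: pointed_involution "corner ?f" \<zero> ?f qinv by (rule pointed_involution_corner[OF f'])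
  have qe: "qinv e = e" using e by (auto simp: idem_def qinv_idem)
  let ?E = "\<lambda>(a, b) (a', b'). adj (a \<oplus> b) (a' \<oplus> b')"
  have "\<exists>v w. hpath ?E ({\<zero>, e} \<times> corner ?f - {(\<zero>, \<zero>)}) v w"
  proof (rule B.hpath_two_rows)
    show "b = b'" if "b \<in> corner ?f - {\<zero>, ?f}" "b' \<in> corner ?f - {\<zero>, ?f}" "qinv b = b" "qinv b' =
        b'" for b b'
      using primitive_fixed[OF f that(1,3)] primitive_fixed[OF f that(2,4)] by simp
    show "?E (d, c) (d', qinv c)" if "c \<in> corner ?f - {\<zero>}" "d \<in> {\<zero>, e}" "d' \<in> {\<zero>, e}" for c d d'
      using adj_two_corners(2)[OF f'(1) e(1) ef(2) that(1), unfolded e(3), OF that(2,3)] by simp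
    show "?E (e, c) (e, c')" if "c \<in> corner ?f" "c' \<in> corner ?f" for c c'
      using adj_two_corners(1)[OF e(1) f'(1) ef(1), of e c c'] that e qe by simp
    show "\<zero> \<noteq> e" using e(2) by simp
  qed
  then obtain v w where "hpath ?E (corner e \<times> corner ?f - {(\<zero>, \<zero>)}) v w" unfolding e(3) by blast
  from hpath_image[OF this inj_on_subset[OF image_two_corners(1)[OF e(1)]], of adj]
  have "hpath adj ((\<lambda>(a, b). a \<oplus> b) ` (corner e \<times> corner ?f - {(\<zero>, \<zero>)})) (case v of (a, b) \<Rightarrow> a \<oplus> b)
      (case w of (a, b) \<Rightarrow> a \<oplus> b)"
    by auto
  then show ?thesis unfolding image_two_corners(2)[OF e(1)] by blast
qed

text \<open>In coordinates, 1 - (0, 1) (a, b) = (1, 1 - b) is a unit unless b = 1. So (0, 1) has no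
  neighbour other than (1, 1).\<close>

lemma Z2_field_neighbours:
  assumes "Z2_field_idem e" and y: "y \<in> carrier R" "y \<noteq> \<one> \<ominus> e"
    and nu: "\<one> \<ominus> (\<one> \<ominus> e) \<otimes> y \<notin> Units R"
  shows "y = \<one>"
proof -
  define f where "f = \<one> \<ominus> e"
  have e: "idem e" "corner e = {\<zero>, e}" and f: "primitive f" using assms
    by (auto simp: Z2_field_idem_def f_def)
  have ce: "e \<in> carrier R" "e \<otimes> e = e" using e by (auto simp: idem_def)
  note ff = idem_compl[OF e(1), folded f_def]
  have cf: "f \<in> carrier R" "f \<otimes> f = f" using ff by (auto simp: idem_def)
  have split: "y = e \<otimes> y \<oplus> f \<otimes> y" using ff(4) y ce cf by (metis l_distr l_one)
  have fy: "f \<otimes> y = f"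
  proof (rule ccontr)
    assume ne: "f \<otimes> y \<noteq> f"
    let ?x = "f \<ominus> f \<otimes> y"
    have x: "?x \<in> carrier R" "?x \<noteq> \<zero>" using ne cf y by auto
    have "f \<otimes> ?x = f \<otimes> f \<ominus> (f \<otimes> f) \<otimes> y" using cf(1) y(1) by algebra
    then have xc: "?x \<in> corner f" using cf y x by (simp add: corner_def)
    define v where "v = qinv ?x"
    have v: "v \<in> carrier R" "?x \<otimes> v = f" "f \<otimes> v = v"
      using primitive_inverse[OF f xc x(2)] x qinv_corner[OF cf(1) x(1)] xc
        by (auto simp: v_def corner_def)
    have ev: "e \<otimes> v = \<zero>" using v ff(2) ce cf by (metis m_assoc l_null)
    have ex: "e \<otimes> ?x = \<zero>" using corner_orth[OF e(1) ff(1,2) xc] .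
    have "\<one> \<ominus> f \<otimes> y = (e \<oplus> f) \<ominus> f \<otimes> y" using ff(4) by simp
    also have "\<dots> = e \<oplus> ?x" using ce(1) cf(1) y(1) by algebra
    finally have u: "\<one> \<ominus> f \<otimes> y = e \<oplus> ?x" .
    have "(e \<oplus> ?x) \<otimes> (e \<oplus> v) = e \<otimes> e \<oplus> e \<otimes> v \<oplus> e \<otimes> ?x \<oplus> ?x \<otimes> v"
      using ce(1) x(1) v(1) by algebra
    also have "\<dots> = \<one>" using ce ev ex v ff(4) by simp
    finally have inv: "(e \<oplus> ?x) \<otimes> (e \<oplus> v) = \<one>" .
    moreover have c: "e \<oplus> ?x \<in> carrier R" "e \<oplus> v \<in> carrier R" using ce x v by simp_all
    ultimately have "e \<oplus> ?x \<in> Units R" unfolding Units_def using m_comm[OF c] by auto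
    then show False using nu u by (simp add: f_def)
  qed
  have "e \<otimes> y \<in> corner e" using ce y by (simp add: corner_def m_assoc [symmetric])
  then consider "e \<otimes> y = \<zero>" | "e \<otimes> y = e" using e(2) by auto
  then show ?thesis
  proof cases
    case 1
    then have "y = f" using split fy cf by simp
    then show ?thesis using y(2) by (simp add: f_def)
  next
    case 2
    then show ?thesis using split fy ff(4) by simp
  qed
qed

end

section \<open>Reduction modulo the Jacobson radical\<close>

definition unit_adj :: "('a, 'm) ring_scheme \<Rightarrow> 'a \<Rightarrow> 'a \<Rightarrow> bool" where
  "unit_adj R x y \<longleftrightarrow> \<one>\<^bsub>R\<^esub> \<ominus>\<^bsub>R\<^esub> x \<otimes>\<^bsub>R\<^esub> y \<notin> Units R"

locale finite_cring = cring R for R (structure) +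
  assumes finite_carrier: "finite (carrier R)" and one_neq_zero: "\<one> \<noteq> \<zero>"
begin

section \<open>Maximal ideals and the quotient by the radical\<close>

lemma ex_maximalideal:
  assumes "ideal I R" and "\<one> \<notin> I"
  shows "\<exists>M. maximalideal M R \<and> I \<subseteq> M"
proof -
  let ?S = "{I'. ideal I' R \<and> I \<subseteq> I' \<and> \<one> \<notin> I'}"
  have "I' \<subseteq> carrier R" if "ideal I' R" for I'
    using additive_subgroup.a_subset[OF ideal.axioms(1)[OF that]] .
  then have "?S \<subseteq> Pow (carrier R)" by auto
  then have "finite ?S" using finite_carrier by (meson finite_Pow_iff finite_subset)
  moreover have "I \<in> ?S" using assms by auto
  ultimately obtain M where M: "M \<in> ?S" "\<forall>I'\<in>?S. M \<subseteq> I' \<longrightarrow> M = I'"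
    using finite_has_maximal2[of ?S I] by auto
  have "maximalideal M R"
  proof (rule maximalidealI)
    show "ideal M R" "carrier R \<noteq> M" using M(1) by auto
    show "J = M \<or> J = carrier R" if "ideal J R" "M \<subseteq> J" "J \<subseteq> carrier R" for J
    proof (cases "\<one> \<in> J")
      case True
      then show ?thesis using ideal.one_imp_carrier[OF that(1)] by simp
    next
      case False
      then have "J \<in> ?S" using that M(1) by auto
      then show ?thesis using M(2) that(2) by blast
    qed
  qed
  then show ?thesis using M(1) by blast
qed

lemma maximalideal_one: "maximalideal M R \<Longrightarrow> \<one> \<notin> M"
  using maximalideal.I_notcarr maximalideal.axioms(1) ideal.one_imp_carrier by metis

lemma ex_maximal: "\<exists>M. maximalideal M R"
  using ex_maximalideal[OF zeroideal] one_neq_zero by auto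

lemma jacobson_radical_eq: "jacobson_radical R = \<Inter>{M. maximalideal M R}"
proof -
  obtain M where M: "maximalideal M R" using ex_maximal by blast
  then have "M \<subseteq> carrier R"
    using additive_subgroup.a_subset ideal.axioms(1) maximalideal.axioms(1) by metis
  then show ?thesis using M unfolding jacobson_radical_def by blast
qed

lemma ideal_jacobson: "ideal (jacobson_radical R) R"
  unfolding jacobson_radical_eq
  by (rule i_Intersect) (use ex_maximal maximalideal.axioms(1) in auto)

lemma one_notin_jacobson: "\<one> \<notin> jacobson_radical R"
  using ex_maximal maximalideal_one unfolding jacobson_radical_eq by blast

lemma square_in_jacobson:
  assumes "x \<in> carrier R" and "x \<otimes> x \<in> jacobson_radical R"
  shows "x \<in> jacobson_radical R"
proof -
  have "x \<in> M" if "maximalideal M R" for M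
  proof -
    have "x \<otimes> x \<in> M" using assms(2) that unfolding jacobson_radical_eq by blast
    then show ?thesis using primeideal.I_prime[OF maximalideal_prime[OF that] assms(1,1)] by blast
  qed
  then show ?thesis unfolding jacobson_radical_eq by blast
qed

text \<open>Modulo the radical such an x is neither zero nor a unit, so x x' will be an idempotent
  other than 0 and 1.\<close>

lemma ex_two_maximal:
  assumes "\<not> local_ring R"
  shows "\<exists>M M' x. maximalideal M R \<and> maximalideal M' R \<and> x \<in> M \<and> x \<notin> M' \<and> x \<in> carrier R"
proof -
  obtain M M' where M: "maximalideal M R" "maximalideal M' R" "M \<noteq> M'"
    using assms ex_maximal is_cring unfolding local_ring_def by blast
  have sub: "M \<subseteq> carrier R" "M' \<subseteq> carrier R"
    using M additive_subgroup.a_subset ideal.axioms(1) maximalideal.axioms(1) by metis+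
  have "\<not> M \<subseteq> M'"
    using maximalideal.I_maximal[OF M(1) maximalideal.axioms(1)[OF M(2)] _ sub(2)] M(3)
      maximalideal.I_notcarr[OF M(2)] by auto
  then show ?thesis using M sub by blast
qed

lemma finite_reduced_Quot:
  "finite_reduced_ring (R Quot jacobson_radical R)"
proof -
  let ?J = "jacobson_radical R"
  interpret J: ideal ?J R by (rule ideal_jacobson)
  interpret S: cring "R Quot ?J" by (rule J.quotient_is_cring) (rule is_cring)
  show ?thesis
  proof
    have "carrier (R Quot ?J) = (\<lambda>x. ?J +> x) ` carrier R"
      by (auto simp: FactRing_def A_RCOSETS_def')
    then show "finite (carrier (R Quot ?J))" using finite_carrier by simp
    have "?J +> \<one> \<noteq> ?J" using one_notin_jacobson J.a_rcos_self[of \<one>] by auto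
    then show "\<one>\<^bsub>R Quot ?J\<^esub> \<noteq> \<zero>\<^bsub>R Quot ?J\<^esub>" by (simp add: FactRing_def)
  next
    fix X assume X: "X \<in> carrier (R Quot ?J)" "X \<otimes>\<^bsub>R Quot ?J\<^esub> X = \<zero>\<^bsub>R Quot ?J\<^esub>"
    then obtain x where x: "x \<in> carrier R" "X = ?J +> x" by (auto simp: FactRing_def A_RCOSETS_def')
    have "?J +> (x \<otimes> x) = ?J" using X(2) x by (simp add: FactRing_def J.rcoset_mult_add)
    then have "x \<otimes> x \<in> ?J" using J.a_rcos_self[of "x \<otimes> x"] x(1) by simp
    then have "x \<in> ?J" by (rule square_in_jacobson[OF x(1)])
    then show "X = \<zero>\<^bsub>R Quot ?J\<^esub>" using x J.a_rcos_const by (simp add: FactRing_def)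
  qed
qed

end

text \<open>There are two instances: the quotient map, and the identity when the radical is zero.
  With the second one, the exceptional case m = 1 speaks of R itself instead of an isomorphic ring
  of cosets.\<close>

locale radical_quotient = finite_cring R + S: finite_reduced_ring S + ring_hom_cring R S h
  for R (structure) and S (structure) and h +
  fixes m :: nat
  assumes card_fibre: "s \<in> carrier S \<Longrightarrow> card {x \<in> carrier R. h x = s} = m"
    and hom_eq_zero: "x \<in> carrier R \<Longrightarrow> h x = \<zero>\<^bsub>S\<^esub> \<longleftrightarrow> x \<in> jacobson_radical R"
begin

text \<open>A homomorphism preserves units, whereas the image of
  \<open>\<one> \<ominus> x \<otimes> y\<close> is annihilated by some nonzero g.\<close>

lemma unit_adj_if_adj:
  assumes x: "x \<in> carrier R" and y: "y \<in> carrier R" and "S.adj (h x) (h y)"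
  shows "unit_adj R x y"
proof -
  from assms(3) obtain g where g: "g \<in> carrier S" "g \<noteq> \<zero>\<^bsub>S\<^esub>" "g \<otimes>\<^bsub>S\<^esub> (h x \<otimes>\<^bsub>S\<^esub> h y) = g"
    unfolding S.adj_def by blast
  have "\<one> \<ominus> x \<otimes> y \<notin> Units R"
  proof
    assume "\<one> \<ominus> x \<otimes> y \<in> Units R"
    then obtain v where v: "v \<in> carrier R" "(\<one> \<ominus> x \<otimes> y) \<otimes> v = \<one>" unfolding Units_def by blast
    let ?t = "h x \<otimes>\<^bsub>S\<^esub> h y"
    have c: "?t \<in> carrier S" "h v \<in> carrier S" using x y v(1) by simp_all
    have "h ((\<one> \<ominus> x \<otimes> y) \<otimes> v) = (\<one>\<^bsub>S\<^esub> \<ominus>\<^bsub>S\<^esub> ?t) \<otimes>\<^bsub>S\<^esub> h v"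
      using x y v(1) by (simp add: a_minus_def)
    then have 1: "(\<one>\<^bsub>S\<^esub> \<ominus>\<^bsub>S\<^esub> ?t) \<otimes>\<^bsub>S\<^esub> h v = \<one>\<^bsub>S\<^esub>" using v(2) by simp
    have "g = g \<otimes>\<^bsub>S\<^esub> ((\<one>\<^bsub>S\<^esub> \<ominus>\<^bsub>S\<^esub> ?t) \<otimes>\<^bsub>S\<^esub> h v)" unfolding 1 using g(1) by simp
    also have "\<dots> = (g \<ominus>\<^bsub>S\<^esub> g \<otimes>\<^bsub>S\<^esub> ?t) \<otimes>\<^bsub>S\<^esub> h v" using g(1) c by algebra
    also have "\<dots> = \<zero>\<^bsub>S\<^esub>" unfolding g(3) using g(1) c by (simp add: S.minus_eq S.r_neg)
    finally show False using g(2) by simp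
  qed
  then show ?thesis by (simp add: unit_adj_def)
qed

text \<open>Numbering the elements of each fibre identifies the vertices of R with \<open>m\<close>
  copies of the nonzero elements of S, so cycles on the copies carry over.\<close>

lemma ex_labelling:
  obtains l where "inj_on l ((carrier S - {\<zero>\<^bsub>S\<^esub>}) \<times> {..<m})"
    and "l ` ((carrier S - {\<zero>\<^bsub>S\<^esub>}) \<times> {..<m}) = carrier R - jacobson_radical R"
    and "\<And>s j t k. (s, j) \<in> (carrier S - {\<zero>\<^bsub>S\<^esub>}) \<times> {..<m} \<Longrightarrow> (t, k) \<in> (carrier S - {\<zero>\<^bsub>S\<^esub>}) \<times> {..<m} \<Longrightarrow>
      S.adj s t \<Longrightarrow> unit_adj R (l (s, j)) (l (t, k))"
proof -
  let ?F = "\<lambda>s. {x \<in> carrier R. h x = s}" and ?S = "carrier S - {\<zero>\<^bsub>S\<^esub>}"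
  have ex: "\<exists>p. bij_betw p {..<m} (?F s)" if "s \<in> carrier S" for s
    using ex_bij_betw_nat_finite[of "?F s"] finite_carrier card_fibre[OF that]
    by (simp add: atLeast0LessThan)
  define p where "p s = (SOME p. bij_betw p {..<m} (?F s))" for s
  have p: "bij_betw (p s) {..<m} (?F s)" if "s \<in> carrier S" for s
    using someI_ex[OF ex[OF that]] unfolding p_def .
  have pF: "p s j \<in> carrier R" "h (p s j) = s" if "s \<in> carrier S" "j < m" for s j
    using bij_betwE[OF p[OF that(1)]] that(2) by auto
  show thesis
  proof (rule that[of "\<lambda>(s, j). p s j"])
    show "inj_on (\<lambda>(s, j). p s j) (?S \<times> {..<m})"
    proof (rule inj_onI)
      fix v w assume vw: "v \<in> ?S \<times> {..<m}" "w \<in> ?S \<times> {..<m}" "(\<lambda>(s, j). p s j) v = (\<lambda>(s, j). p s j)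
          w"
      obtain s j t k where v: "v = (s, j)" "w = (t, k)" by (metis surj_pair)
      have *: "s \<in> carrier S" "t \<in> carrier S" "j < m" "k < m" "p s j = p t k" using vw v by auto
      have "s = t" using pF(2)[OF *(1,3)] pF(2)[OF *(2,4)] *(5) by simp
      moreover from this have "j = k"
        using inj_onD[OF bij_betw_imp_inj_on[OF p[OF *(1)]], of j k] * by simp
      ultimately show "v = w" by (simp add: v)
    qed
    show "(\<lambda>(s, j). p s j) ` (?S \<times> {..<m}) = carrier R - jacobson_radical R"
    proof (intro equalityI subsetI)
      fix x assume "x \<in> (\<lambda>(s, j). p s j) ` (?S \<times> {..<m})"
      then obtain s j where x: "x = p s j" "s \<in> ?S" "j < m" by auto
      have "h x \<noteq> \<zero>\<^bsub>S\<^esub>" "x \<in> carrier R" using pF[of s j] x by auto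
      then show "x \<in> carrier R - jacobson_radical R" using hom_eq_zero by blast
    next
      fix x assume x: "x \<in> carrier R - jacobson_radical R"
      then have hx: "h x \<in> ?S" using hom_eq_zero by auto
      then have "x \<in> p (h x) ` {..<m}" using bij_betw_imp_surj_on[OF p[of "h x"]] x by auto
      then show "x \<in> (\<lambda>(s, j). p s j) ` (?S \<times> {..<m})" using hx by force
    qed
    show "unit_adj R ((\<lambda>(s, j). p s j) (s, j)) ((\<lambda>(s, j). p s j) (t, k))"
      if "(s, j) \<in> ?S \<times> {..<m}" "(t, k) \<in> ?S \<times> {..<m}" "S.adj s t" for s j t k
      using that pF by (auto intro!: unit_adj_if_adj)
  qed
qed

lemma m_pos: "0 < m"
proof -
  have "\<one> \<in> {x \<in> carrier R. h x = \<one>\<^bsub>S\<^esub>}" by simp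
  moreover have "finite {x \<in> carrier R. h x = \<one>\<^bsub>S\<^esub>}" using finite_carrier by simp
  ultimately have "card {x \<in> carrier R. h x = \<one>\<^bsub>S\<^esub>} > 0" using card_gt_0_iff by blast
  then show ?thesis using card_fibre[of "\<one>\<^bsub>S\<^esub>"] by simp
qed

lemma hcycle_unit_adj:
  assumes "\<not> local_ring R" and "m = 1 \<Longrightarrow> \<nexists>e. S.Z2_field_idem e"
  shows "hcycle (unit_adj R) (carrier R - jacobson_radical R)"
proof -
  obtain M M' x where M: "maximalideal M R" "maximalideal M' R"
    and x: "x \<in> M" "x \<notin> M'" "x \<in> carrier R"
    using ex_two_maximal[OF assms(1)] by blast
  let ?e = "h x \<otimes>\<^bsub>S\<^esub> S.qinv (h x)"
  have hx: "h x \<in> carrier S" using x by simp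
  have "x \<notin> jacobson_radical R" using x M unfolding jacobson_radical_eq by blast
  then have "h x \<noteq> \<zero>\<^bsub>S\<^esub>" using hom_eq_zero x by simp
  then have e: "S.idem ?e" "?e \<noteq> \<zero>\<^bsub>S\<^esub>" using S.idem_qinv[OF hx] by auto
  \<comment> \<open>Otherwise x would be invertible modulo the radical, although it lies in the
    maximal ideal M.\<close>
  have "?e \<noteq> \<one>\<^bsub>S\<^esub>"
  proof
    assume e1: "?e = \<one>\<^bsub>S\<^esub>"
    have "card {y \<in> carrier R. h y = S.qinv (h x)} = m" by (rule card_fibre) (use hx in simp)
    then have "{y \<in> carrier R. h y = S.qinv (h x)} \<noteq> {}" using m_pos by force
    then obtain y where y: "y \<in> carrier R" "h y = S.qinv (h x)" by blast
    have "h (\<one> \<ominus> x \<otimes> y) = \<zero>\<^bsub>S\<^esub>" using x y e1 by (simp add: a_minus_def S.r_neg)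
    moreover have "\<one> \<ominus> x \<otimes> y \<in> carrier R" using x(3) y(1) by simp
    ultimately have "\<one> \<ominus> x \<otimes> y \<in> jacobson_radical R" using hom_eq_zero by blast
    then have "\<one> \<ominus> x \<otimes> y \<in> M" using M(1) unfolding jacobson_radical_eq by blast
    moreover interpret M: maximalideal M R by fact
    have "x \<otimes> y \<in> M" using x y by (simp add: M.I_r_closed)
    ultimately have "(\<one> \<ominus> x \<otimes> y) \<oplus> x \<otimes> y \<in> M" by (rule M.a_closed)
    moreover have "(\<one> \<ominus> x \<otimes> y) \<oplus> x \<otimes> y = \<one>" using x(3) y(1) by algebra
    ultimately show False using maximalideal_one[OF M(1)] by simp
  qed
  from S.hcycle_blow_up_adj[OF e this m_pos assms(2)]
  have cyc: "hcycle (\<lambda>(x, j) (y, k). S.adj x y) ((carrier S - {\<zero>\<^bsub>S\<^esub>}) \<times> {..<m})" .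
  obtain l where l: "inj_on l ((carrier S - {\<zero>\<^bsub>S\<^esub>}) \<times> {..<m})"
    "l ` ((carrier S - {\<zero>\<^bsub>S\<^esub>}) \<times> {..<m}) = carrier R - jacobson_radical R"
    "\<And>s j t k. (s, j) \<in> (carrier S - {\<zero>\<^bsub>S\<^esub>}) \<times> {..<m} \<Longrightarrow> (t, k) \<in> (carrier S - {\<zero>\<^bsub>S\<^esub>}) \<times> {..<m} \<Longrightarrow>
      S.adj s t \<Longrightarrow> unit_adj R (l (s, j)) (l (t, k))"
    using ex_labelling by blast
  have "hcycle (unit_adj R) (l ` ((carrier S - {\<zero>\<^bsub>S\<^esub>}) \<times> {..<m}))"
  proof (rule hcycle_image[OF cyc l(1)])
    fix v w assume *: "v \<in> (carrier S - {\<zero>\<^bsub>S\<^esub>}) \<times> {..<m}" "w \<in> (carrier S - {\<zero>\<^bsub>S\<^esub>}) \<times> {..<m}"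
      "(\<lambda>(x, j) (y, k). S.adj x y) v w"
    obtain s j t k where "v = (s, j)" "w = (t, k)" by (metis surj_pair)
    then show "unit_adj R (l v) (l w)" using l(3)[of s j t k] * by simp
  qed
  then show ?thesis unfolding l(2) .
qed

end

lemma (in finite_cring) radical_quotient_Quot:
  "radical_quotient R (R Quot jacobson_radical R) (\<lambda>x. jacobson_radical R +> x) (card
      (jacobson_radical R))"
proof -
  let ?J = "jacobson_radical R"
  have carr: "carrier (R Quot ?J) = a_rcosets ?J" and zero: "\<zero>\<^bsub>R Quot ?J\<^esub> = ?J"
    by (simp_all add: FactRing_def)
  interpret J: ideal ?J R by (rule ideal_jacobson)
  interpret S: finite_reduced_ring "R Quot ?J" by (rule finite_reduced_Quot)
  interpret H: ring_hom_cring R "R Quot ?J" "(+>) ?J"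
    by (rule J.rcos_ring_hom_cring) (rule is_cring)
  show ?thesis
  proof
    fix s assume "s \<in> carrier (R Quot ?J)"
    then have s: "s \<in> a_rcosets ?J" unfolding carr .
    then obtain x where x: "x \<in> carrier R" "s = ?J +> x" unfolding A_RCOSETS_def' by blast
    have "{y \<in> carrier R. ?J +> y = s} = s"
      using J.a_rcos_self J.a_repr_independence'[OF _ x(1)] J.a_rcosets_carrier[OF s] x(2) by blast
    then show "card {y \<in> carrier R. ?J +> y = s} = card ?J"
      using a_card_cosets_equal[OF s J.a_subset finite_carrier] by simp
  next
    fix x assume x: "x \<in> carrier R"
    have "?J +> x = ?J \<longleftrightarrow> x \<in> ?J" using J.a_rcos_self[OF x] J.a_rcos_const by blast
    then show "?J +> x = \<zero>\<^bsub>R Quot ?J\<^esub> \<longleftrightarrow> x \<in> ?J" unfolding zero .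
  qed
qed

lemma (in finite_reduced_ring) finite_cring: "finite_cring R"
  by unfold_locales (rule finite_carrier, rule one_neq_zero)

text \<open>With x the idempotent e = x x' lies in the radical. Then 1 - e lies in no maximal ideal
  and generates the ring, but it annihilates e.\<close>

lemma (in finite_reduced_ring) jacobson_radical_eq_zero: "jacobson_radical R = {\<zero>}"
proof -
  interpret finite_cring R by (rule finite_cring)
  interpret J: ideal "jacobson_radical R" R by (rule ideal_jacobson)
  have "x = \<zero>" if x: "x \<in> jacobson_radical R" for x
  proof -
    have xc: "x \<in> carrier R" using J.a_subset x by auto
    define e where "e = x \<otimes> qinv x"
    have e: "e \<in> carrier R" "e \<otimes> e = e" "e \<in> jacobson_radical R"
      using idem_qinv(1)[OF xc] J.I_r_closed[OF x] xc by (auto simp: idem_def e_def)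
    show ?thesis
    proof (cases "\<one> \<in> PIdl (\<one> \<ominus> e)")
      case True
      then obtain v where v: "v \<in> carrier R" "\<one> = v \<otimes> (\<one> \<ominus> e)" by (auto simp: cgenideal_def)
      have "e = e \<otimes> (v \<otimes> (\<one> \<ominus> e))" using v(2)[symmetric] e by simp
      also have "\<dots> = v \<otimes> (e \<ominus> e \<otimes> e)" using v(1) e(1) by algebra
      also have "\<dots> = \<zero>" using v(1) e by (simp add: minus_eq r_neg)
      finally show ?thesis using idem_qinv(2)[OF xc] by (simp add: e_def)
    next
      case False
      have "ideal (PIdl (\<one> \<ominus> e)) R" using e(1) by (intro cgenideal_ideal) simp
      then obtain M where M: "maximalideal M R" "PIdl (\<one> \<ominus> e) \<subseteq> M" using ex_maximalideal False
        by blast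
      interpret M: maximalideal M R by fact
      have "\<one> \<ominus> e \<in> M" "e \<in> M"
        using M(2) cgenideal_self[of "\<one> \<ominus> e"] e M(1) unfolding jacobson_radical_eq by auto
      then have "(\<one> \<ominus> e) \<oplus> e \<in> M" by (rule M.a_closed)
      moreover have "(\<one> \<ominus> e) \<oplus> e = \<one>" using e(1) by algebra
      ultimately show ?thesis using maximalideal_one[OF M(1)] by simp
    qed
  qed
  then show ?thesis using J.zero_closed by auto
qed

lemma (in finite_reduced_ring) radical_quotient_id: "radical_quotient R R (\<lambda>x. x) 1"
proof -
  interpret finite_cring R by (rule finite_cring)
  show ?thesis
  proof
    show "(\<lambda>x. x) \<in> ring_hom R R" by (rule ring_hom_memI) auto
    show "card {x \<in> carrier R. x = s} = 1" if "s \<in> carrier R" for s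
    proof -
      have "{x \<in> carrier R. x = s} = {s}" using that by auto
      then show ?thesis by simp
    qed
    show "x = \<zero> \<longleftrightarrow> x \<in> jacobson_radical R" for x by (simp add: jacobson_radical_eq_zero)
  qed
qed

lemma (in finite_cring) finite_reduced_if_jacobson_zero:
  assumes "jacobson_radical R = {\<zero>}"
  shows "finite_reduced_ring R"
proof
  show "x = \<zero>" if "x \<in> carrier R" "x \<otimes> x = \<zero>" for x
    using square_in_jacobson[OF that(1)] that(2) unfolding assms by simp
qed (rule finite_carrier, rule one_neq_zero)

text \<open>A nonzero radical has at least two elements, so m = 1 cannot occur for the quotient map.
  Only for zero radical, where R is reduced, does the exception have to be excluded.\<close>

lemma (in finite_cring) hcycle_unit_adj:
  assumes "\<not> local_ring R" and exc: "finite_reduced_ring R \<Longrightarrow> \<nexists>e. finite_reduced_ring.Z2_field_idem R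
      e"
  shows "hcycle (unit_adj R) (carrier R - jacobson_radical R)"
proof (cases "jacobson_radical R = {\<zero>}")
  case True
  interpret S: finite_reduced_ring R by (rule finite_reduced_if_jacobson_zero[OF True])
  interpret radical_quotient R R "\<lambda>x. x" 1 by (rule S.radical_quotient_id)
  show ?thesis using hcycle_unit_adj[OF assms(1)] exc[OF S.finite_reduced_ring_axioms] by simp
next
  case False
  interpret radical_quotient R "R Quot jacobson_radical R" "\<lambda>x. jacobson_radical R +> x" "card
      (jacobson_radical R)"
    by (rule radical_quotient_Quot)
  interpret J: ideal "jacobson_radical R" R by (rule ideal_jacobson)
  have "card (jacobson_radical R) \<noteq> 1"
    using False J.zero_closed by (metis card_1_singletonE singletonD)
  then show ?thesis using hcycle_unit_adj[OF assms(1)] by simp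
qed

lemma (in finite_reduced_ring) hpath_unit_adj:
  assumes "Z2_field_idem e"
  shows "\<exists>v w. hpath (unit_adj R) (carrier R - jacobson_radical R) v w"
proof -
  obtain v w where "hpath adj (carrier R - {\<zero>}) v w" using hpath_Z2_field[OF assms] by blast
  then have "hpath (unit_adj R) ((\<lambda>x. x) ` (carrier R - {\<zero>})) v w"
  proof (rule hpath_image[where f = "\<lambda>x. x"])
    show "unit_adj R x y" if "x \<in> carrier R - {\<zero>}" "y \<in> carrier R - {\<zero>}" "adj x y" for x y
      by (rule radical_quotient.unit_adj_if_adj[OF radical_quotient_id]) (use that in simp_all)
  qed simp
  then have "hpath (unit_adj R) (carrier R - jacobson_radical R) v w"
    unfolding jacobson_radical_eq_zero by simp
  then show ?thesis by blast
qed

section \<open>Decompositions with a factor of order two\<close>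

lemma RDirProd_simps:
  "carrier (RDirProd R S) = carrier R \<times> carrier S"
  "(a, b) \<otimes>\<^bsub>RDirProd R S\<^esub> (c, d) = (a \<otimes>\<^bsub>R\<^esub> c, b \<otimes>\<^bsub>S\<^esub> d)"
  "(a, b) \<oplus>\<^bsub>RDirProd R S\<^esub> (c, d) = (a \<oplus>\<^bsub>R\<^esub> c, b \<oplus>\<^bsub>S\<^esub> d)"
  "\<one>\<^bsub>RDirProd R S\<^esub> = (\<one>\<^bsub>R\<^esub>, \<one>\<^bsub>S\<^esub>)" "\<zero>\<^bsub>RDirProd R S\<^esub> = (\<zero>\<^bsub>R\<^esub>, \<zero>\<^bsub>S\<^esub>)"
  by (simp_all add: RDirProd_def DirProd_def monoid.defs)

lemma residue_ring_2_simps: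
  "carrier (residue_ring 2) = {0, 1}" "\<one>\<^bsub>residue_ring 2\<^esub> = 1" "\<zero>\<^bsub>residue_ring 2\<^esub> = 0"
  "a \<otimes>\<^bsub>residue_ring 2\<^esub> b = (a * b) mod 2" "a \<oplus>\<^bsub>residue_ring 2\<^esub> b = (a + b) mod 2"
  by (auto simp: residue_ring_def)

context finite_reduced_ring
begin

text \<open>It has the element type of R, so the corner of 1 - e can serve as the witness
  \<open>F :: 'a ring\<close> in the theorem.\<close>

definition corner_ring :: "'a \<Rightarrow> 'a ring" where
  "corner_ring e = \<lparr>carrier = corner e, monoid.mult = (\<otimes>), one = e, zero = \<zero>, add = (\<oplus>)\<rparr>"

lemma corner_closed:
  assumes "idem e" and "x \<in> corner e" and "y \<in> corner e"
  shows "x \<oplus> y \<in> corner e" and "x \<otimes> y \<in> corner e" and "\<ominus> x \<in> corner e"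
  using assms by (auto simp: corner_def idem_def r_distr r_minus m_assoc [symmetric])

lemma field_corner_ring:
  assumes "primitive e"
  shows "field (corner_ring e)"
proof -
  have e: "idem e" "e \<noteq> \<zero>" using assms by (auto simp: primitive_def)
  have ce: "x \<in> carrier R" "e \<otimes> x = x" if "x \<in> corner e" for x using that by (auto simp: corner_def)
  have ein: "e \<in> corner e" using e by (auto simp: corner_def idem_def)
  have "cring (corner_ring e)"
  proof (rule cringI)
    show "abelian_group (corner_ring e)"
    proof (rule abelian_groupI)
      fix x assume "x \<in> carrier (corner_ring e)"
      then have "\<ominus> x \<in> corner e" "\<ominus> x \<oplus> x = \<zero>"
        using corner_closed(3)[OF e(1)] ce by (auto simp: corner_ring_def l_neg)
      then show "\<exists>y\<in>carrier (corner_ring e). y \<oplus>\<^bsub>corner_ring e\<^esub> x = \<zero>\<^bsub>corner_ring e\<^esub>"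
        by (auto simp: corner_ring_def)
    qed (use ce corner_closed[OF e(1)] zero_in_corner[OF e(1)] in \<open>auto simp: corner_ring_def a_ac\<close>)
    show "comm_monoid (corner_ring e)"
      by (rule comm_monoidI)
         (auto simp: corner_ring_def ce ein corner_closed[OF e(1)] m_assoc intro: m_comm)
  qed (use ce in \<open>auto simp: corner_ring_def l_distr\<close>)
  then show ?thesis
  proof (rule cring.cring_fieldI2)
    show "\<zero>\<^bsub>corner_ring e\<^esub> \<noteq> \<one>\<^bsub>corner_ring e\<^esub>" using e by (simp add: corner_ring_def)
    fix a assume a: "a \<in> carrier (corner_ring e)" "a \<noteq> \<zero>\<^bsub>corner_ring e\<^esub>"
    then have "a \<otimes> qinv a = e" by (intro primitive_inverse[OF assms]) (auto simp: corner_ring_def)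
    moreover have ac: "a \<in> corner e" using a by (simp add: corner_ring_def)
    then have "qinv a \<in> corner e"
      using qinv_corner[OF idemD(1)[OF e(1)] ce[OF ac]] qinv_closed[OF ce(1)[OF ac]]
        by (simp add: corner_def)
    ultimately show "\<exists>b\<in>carrier (corner_ring e). a \<otimes>\<^bsub>corner_ring e\<^esub> b = \<one>\<^bsub>corner_ring e\<^esub>"
      by (auto simp: corner_ring_def)
  qed
qed

lemma Z2_plus_corner_ring:
  assumes "Z2_field_idem e"
  shows "Z2_plus_finite_field R (corner_ring (\<one> \<ominus> e))"
proof -
  define f where "f = \<one> \<ominus> e"
  have e: "idem e" "e \<noteq> \<zero>" "corner e = {\<zero>, e}" and f: "primitive f"
    using assms by (auto simp: Z2_field_idem_def f_def)
  have ce: "e \<in> carrier R" "e \<otimes> e = e" using e by (auto simp: idem_def)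
  note ff = idem_compl[OF e(1), folded f_def]
  have cf: "f \<in> carrier R" "f \<otimes> f = f" using ff by (auto simp: idem_def)
  have ex: "e \<otimes> x = \<zero> \<or> e \<otimes> x = e" if "x \<in> carrier R" for x
  proof -
    have "e \<otimes> x \<in> corner e" using ce that by (simp add: corner_def m_assoc [symmetric])
    then show ?thesis using e(3) by auto
  qed
  \<comment> \<open>The first corner has characteristic 2, which makes the first component of
    \<open>\<phi>\<close> additive modulo 2.\<close>
  have ee: "e \<oplus> e = \<zero>"
  proof -
    have "e \<oplus> e \<in> corner e" using corner_closed(1)[OF e(1)] e(3) by auto
    then consider "e \<oplus> e = \<zero>" | "e \<oplus> e = e" using e(3) by auto
    then show ?thesis
    proof cases
      case 2
      then have "e = \<zero>" using ce by (metis add.l_cancel_one)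
      then show ?thesis using e(2) by simp
    qed
  qed
  define \<phi> where "\<phi> x = (if e \<otimes> x = \<zero> then 0 else 1 :: int, f \<otimes> x)" for x
  have "\<phi> \<in> ring_iso R (RDirProd (residue_ring 2) (corner_ring f))"
  proof (rule ring_iso_memI)
    fix x y assume x: "x \<in> carrier R" and y: "y \<in> carrier R"
    show "\<phi> x \<in> carrier (RDirProd (residue_ring 2) (corner_ring f))"
      using x cf by (simp add: \<phi>_def RDirProd_simps residue_ring_2_simps corner_ring_def corner_def
        m_assoc [symmetric])
    have exy: "e \<otimes> (x \<otimes> y) = (e \<otimes> x) \<otimes> (e \<otimes> y)" "f \<otimes> (x \<otimes> y) = (f \<otimes> x) \<otimes> (f \<otimes> y)"
    proof -
      have "(e \<otimes> x) \<otimes> (e \<otimes> y) = (e \<otimes> e) \<otimes> (x \<otimes> y)" "(f \<otimes> x) \<otimes> (f \<otimes> y) = (f \<otimes> f) \<otimes> (x \<otimes> y)"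
        using x y ce(1) cf(1) by algebra+
      then show "e \<otimes> (x \<otimes> y) = (e \<otimes> x) \<otimes> (e \<otimes> y)" "f \<otimes> (x \<otimes> y) = (f \<otimes> x) \<otimes> (f \<otimes> y)"
        using ce cf by simp_all
    qed
    show "\<phi> (x \<otimes> y) = \<phi> x \<otimes>\<^bsub>RDirProd (residue_ring 2) (corner_ring f)\<^esub> \<phi> y"
      using ex[OF x] ex[OF y] e(2) ce cf
      by (auto simp: \<phi>_def exy RDirProd_simps residue_ring_2_simps corner_ring_def)
    have exy': "e \<otimes> (x \<oplus> y) = (e \<otimes> x) \<oplus> (e \<otimes> y)" "f \<otimes> (x \<oplus> y) = (f \<otimes> x) \<oplus> (f \<otimes> y)"
      using x y ce(1) cf(1) by (simp_all add: r_distr)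
    show "\<phi> (x \<oplus> y) = \<phi> x \<oplus>\<^bsub>RDirProd (residue_ring 2) (corner_ring f)\<^esub> \<phi> y"
      using ex[OF x] ex[OF y] e(2) ce cf ee
      by (auto simp: \<phi>_def exy' RDirProd_simps residue_ring_2_simps corner_ring_def)
  next
    show "\<phi> \<one> = \<one>\<^bsub>RDirProd (residue_ring 2) (corner_ring f)\<^esub>"
      using e(2) ce cf by (simp add: \<phi>_def RDirProd_simps residue_ring_2_simps corner_ring_def)
    show "bij_betw \<phi> (carrier R) (carrier (RDirProd (residue_ring 2) (corner_ring f)))"
    proof (rule bij_betw_byWitness[where f' = "\<lambda>(a, b). (if a = 0 then \<zero> else e) \<oplus> b"])
      show "\<forall>x\<in>carrier R. (case \<phi> x of (a, b) \<Rightarrow> (if a = 0 then \<zero> else e) \<oplus> b) = x"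
      proof
        fix x assume x: "x \<in> carrier R"
        have eq: "(if e \<otimes> x = \<zero> then \<zero> else e) = e \<otimes> x" using ex[OF x] by auto
        have "(case \<phi> x of (a, b) \<Rightarrow> (if a = 0 then \<zero> else e) \<oplus> b) = (if e \<otimes> x = \<zero> then \<zero> else e) \<oplus> f
            \<otimes> x"
          by (simp add: \<phi>_def)
        also have "\<dots> = x" unfolding eq using ff(4) x ce cf by (metis l_distr l_one)
        finally show "(case \<phi> x of (a, b) \<Rightarrow> (if a = 0 then \<zero> else e) \<oplus> b) = x" .
      qed
      show "\<phi> ` carrier R \<subseteq> carrier (RDirProd (residue_ring 2) (corner_ring f))"
        using cf by (auto simp: \<phi>_def RDirProd_simps residue_ring_2_simps corner_ring_def corner_def
          m_assoc [symmetric])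
      show "(\<lambda>(a, b). (if a = 0 then \<zero> else e) \<oplus> b) ` carrier (RDirProd (residue_ring 2)
          (corner_ring f)) \<subseteq> carrier R"
        using ce by (auto simp: RDirProd_simps residue_ring_2_simps corner_ring_def corner_def)
      have "\<phi> ((if a = 0 then \<zero> else e) \<oplus> b) = (a, b)" if "a \<in> {0, 1}" "b \<in> corner f" for a b
        using bij_betw_corners(2,3)[OF e(1) ff(1,2), of "if a = 0 then \<zero> else e" b] that e(2,3)
        by (auto simp: \<phi>_def split: if_splits)
      then show "\<forall>v\<in>carrier (RDirProd (residue_ring 2) (corner_ring f)).
          \<phi> (case v of (a, b) \<Rightarrow> (if a = 0 then \<zero> else e) \<oplus> b) = v"
        by (auto simp: RDirProd_simps residue_ring_2_simps corner_ring_def)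
    qed
  qed
  moreover have "finite (carrier (corner_ring f))"
    using finite_carrier corner_subset[of f] finite_subset by (auto simp: corner_ring_def)
  ultimately show ?thesis
    using field_corner_ring[OF f] unfolding Z2_plus_finite_field_def is_ring_iso_def f_def by blast
qed

end

lemma (in finite_cring) Z2_plus_imp_finite_reduced:
  assumes "Z2_plus_finite_field R F"
  shows "finite_reduced_ring R" and "\<exists>e. finite_reduced_ring.Z2_field_idem R e"
proof -
  interpret F: field F using assms by (simp add: Z2_plus_finite_field_def)
  let ?P = "RDirProd (residue_ring 2) F"
  from assms obtain \<phi> where \<phi>: "\<phi> \<in> ring_iso R ?P"
    by (auto simp: Z2_plus_finite_field_def is_ring_iso_def)
  note hom = ring_iso_memE[OF \<phi>]
  have inj: "x = y" if "\<phi> x = \<phi> y" "x \<in> carrier R" "y \<in> carrier R" for x y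
    using inj_onD[OF bij_betw_imp_inj_on[OF hom(5)] that] .
  have surj: "\<exists>x\<in>carrier R. \<phi> x = v" if "v \<in> carrier ?P" for v
  proof -
    have "v \<in> \<phi> ` carrier R" using bij_betw_imp_surj_on[OF hom(5)] that by simp
    then show ?thesis by blast
  qed
  have \<phi>c: "\<exists>a b. \<phi> x = (a, b) \<and> a \<in> {0, 1} \<and> b \<in> carrier F" if "x \<in> carrier R" for x
    using hom(1)[OF that] by (auto simp: RDirProd_simps residue_ring_2_simps)
  \<comment> \<open>The image of zero is found from 0 + 0 = 0, componentwise.\<close>
  have \<phi>0: "\<phi> \<zero> = (0, \<zero>\<^bsub>F\<^esub>)"
  proof -
    obtain a b where ab: "\<phi> \<zero> = (a, b)" "a \<in> {0, 1}" "b \<in> carrier F" using \<phi>c[OF zero_closed]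
      by blast
    have "\<phi> \<zero> = \<phi> \<zero> \<oplus>\<^bsub>?P\<^esub> \<phi> \<zero>" using hom(3)[OF zero_closed zero_closed] by simp
    then have "a = (a + a) mod 2" "b = b \<oplus>\<^bsub>F\<^esub> b" using ab
      by (simp_all add: RDirProd_simps residue_ring_2_simps)
    then show ?thesis using ab F.add.l_cancel_one[of b b] by auto
  qed
  show red: "finite_reduced_ring R"
  proof
    fix x assume x: "x \<in> carrier R" "x \<otimes> x = \<zero>"
    obtain a b where ab: "\<phi> x = (a, b)" "a \<in> {0, 1}" "b \<in> carrier F" using \<phi>c[OF x(1)] by blast
    have "\<phi> x \<otimes>\<^bsub>?P\<^esub> \<phi> x = (0, \<zero>\<^bsub>F\<^esub>)" using hom(2)[OF x(1,1)] x(2) \<phi>0 by simp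
    then have "(a * a) mod 2 = 0" "b \<otimes>\<^bsub>F\<^esub> b = \<zero>\<^bsub>F\<^esub>"
      using ab by (simp_all add: RDirProd_simps residue_ring_2_simps)
    then have "\<phi> x = \<phi> \<zero>" using ab F.integral[of b b] \<phi>0 by auto
    then show "x = \<zero>" using inj x(1) by blast
  qed (rule finite_carrier, rule one_neq_zero)
  interpret R: finite_reduced_ring R by (rule red)
  obtain e where e: "e \<in> carrier R" "\<phi> e = (1, \<zero>\<^bsub>F\<^esub>)"
    using surj[of "(1, \<zero>\<^bsub>F\<^esub>)"] by (auto simp: RDirProd_simps residue_ring_2_simps)
  obtain f where f: "f \<in> carrier R" "\<phi> f = (0, \<one>\<^bsub>F\<^esub>)"
    using surj[of "(0, \<one>\<^bsub>F\<^esub>)"] by (auto simp: RDirProd_simps residue_ring_2_simps)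
  have "\<phi> (e \<oplus> f) = \<phi> \<one>"
    using hom(3)[OF e(1) f(1)] hom(4) e f by (simp add: RDirProd_simps residue_ring_2_simps)
  then have "e \<oplus> f = \<one>" using inj e f by simp
  moreover have "e \<oplus> f \<ominus> e = f" using e(1) f(1) by algebra
  ultimately have f_eq: "\<one> \<ominus> e = f" by simp
  have mul: "e \<otimes> e = e" "f \<otimes> f = f"
    using inj[of "e \<otimes> e" e] inj[of "f \<otimes> f" f] hom(2) e f
      by (simp_all add: RDirProd_simps residue_ring_2_simps)
  have e0: "e \<noteq> \<zero>" "f \<noteq> \<zero>" using e f \<phi>0 by auto
  have ce: "x = \<zero> \<or> x = e" if "x \<in> R.corner e" for x
  proof -
    have x: "x \<in> carrier R" "e \<otimes> x = x" using that by (auto simp: R.corner_def)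
    obtain a b where ab: "\<phi> x = (a, b)" "a \<in> {0, 1}" "b \<in> carrier F" using \<phi>c[OF x(1)] by blast
    have "\<phi> e \<otimes>\<^bsub>?P\<^esub> \<phi> x = \<phi> x" using hom(2)[OF e(1) x(1)] x(2) by simp
    then have "b = \<zero>\<^bsub>F\<^esub>" using ab e by (simp add: RDirProd_simps)
    then have "\<phi> x = \<phi> \<zero> \<or> \<phi> x = \<phi> e" using ab e \<phi>0 by auto
    then show ?thesis using inj x(1) e(1) by blast
  qed
  have "R.primitive f"
    unfolding R.primitive_def
  proof (intro conjI ballI impI)
    show "R.idem f" using f mul by (simp add: R.idem_def)
    show "f \<noteq> \<zero>" by (fact e0)
    fix g assume "g \<in> R.corner f" "R.idem g"
    then have g: "g \<in> carrier R" "f \<otimes> g = g" "g \<otimes> g = g" by (auto simp: R.corner_def R.idem_def)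
    obtain a b where ab: "\<phi> g = (a, b)" "a \<in> {0, 1}" "b \<in> carrier F" using \<phi>c[OF g(1)] by blast
    have "\<phi> f \<otimes>\<^bsub>?P\<^esub> \<phi> g = \<phi> g" using hom(2)[OF f(1) g(1)] g(2) by simp
    then have a: "a = 0" using ab f by (simp add: RDirProd_simps residue_ring_2_simps)
    have "\<phi> g \<otimes>\<^bsub>?P\<^esub> \<phi> g = \<phi> g" using hom(2)[OF g(1) g(1)] g(3) by simp
    then have "b \<otimes>\<^bsub>F\<^esub> b = b \<otimes>\<^bsub>F\<^esub> \<one>\<^bsub>F\<^esub>" using ab by (simp add: RDirProd_simps)
    then have "b = \<zero>\<^bsub>F\<^esub> \<or> b = \<one>\<^bsub>F\<^esub>" using F.m_lcancel[of b b "\<one>\<^bsub>F\<^esub>"] ab(3) by blast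
    then have "\<phi> g = \<phi> \<zero> \<or> \<phi> g = \<phi> f" using ab a f \<phi>0 by auto
    then show "g = \<zero> \<or> g = f" using inj g(1) f(1) by blast
  qed
  moreover have "R.corner e = {\<zero>, e}"
    using ce e mul by (auto simp: R.corner_def)
  ultimately have "R.Z2_field_idem e"
    using e mul e0 unfolding R.Z2_field_idem_def f_eq by (simp add: R.idem_def)
  then show "\<exists>e. R.Z2_field_idem e" by blast
qed

section \<open>Hamiltonian cycles and paths of graphs\<close>

text \<open>Zipping a vertex list with its tail gives the arcs of the walk through it. For a cycle
  the list is \<open>xs @ [hd xs]\<close>.\<close>

lemma pcas_zip_tl: "xs \<noteq> [] \<Longrightarrow> pcas (hd xs) (zip xs (tl xs)) (last xs)"
  by (induction xs rule: induct_list012) auto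

lemma pawalk_verts_zip_tl: "xs \<noteq> [] \<Longrightarrow> pawalk_verts (hd xs) (zip xs (tl xs)) = xs"
  by (induction xs rule: induct_list012) auto

lemma set_zip_tl: "successively (\<lambda>x y. (x, y) \<in> A) xs \<Longrightarrow> set (zip xs (tl xs)) \<subseteq> A"
  by (induction xs rule: induct_list012) auto

lemma map_fst_zip_tl: "map fst (zip xs (tl xs)) = butlast xs"
  by (induction xs rule: induct_list012) auto

lemma pawalk_verts_conv: "pcas u p v \<Longrightarrow> pawalk_verts u p = map fst p @ [v]"
  by (induction p arbitrary: u) auto

lemma pcas_nth:
  "pcas u p v \<Longrightarrow> i < length p \<Longrightarrow> snd (p ! i) = (if Suc i < length p then fst (p ! Suc i) else v)"
proof (induction p arbitrary: u i)
  case (Cons a p)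
  then show ?case by (cases i; cases p) auto
qed simp

text \<open>A list without repetitions never uses a loop, so the loops of the relations above do no
  harm in graphs.\<close>

lemma successively_distinct:
  "successively E xs \<Longrightarrow> distinct xs \<Longrightarrow> successively (\<lambda>x y. E x y \<and> x \<noteq> y) xs"
  by (induction xs rule: induct_list012) auto

lemma hamiltonian_if_hcycle:
  assumes cyc: "hcycle E (pverts G)" and card: "3 \<le> card (pverts G)"
    and arcs: "\<And>x y. x \<in> pverts G \<Longrightarrow> y \<in> pverts G \<Longrightarrow> x \<noteq> y \<Longrightarrow> E x y \<Longrightarrow> (x, y) \<in> parcs G"
  shows "hamiltonian G"
proof -
  obtain xs where xs: "xs \<noteq> []" "distinct xs" "set xs = pverts G" "successively E xs" "E (last xs)
      (hd xs)"
    using cyc unfolding hcycle_def hpath_def by blast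
  have len: "3 \<le> length xs" using card xs(2,3) distinct_card by metis
  let ?ys = "xs @ [hd xs]" and ?A = "\<lambda>x y. (x, y) \<in> parcs G"
  have "successively ?A xs"
    using successively_distinct[OF xs(4,2)] by (rule successively_mono) (use arcs xs(3) in auto)
  \<comment> \<open>With at least three vertices the closing edge is not a loop, hence an
    arc.\<close>
  moreover have "last xs \<noteq> hd xs"
  proof
    assume "last xs = hd xs"
    then have "xs ! (length xs - 1) = xs ! 0" using xs(1) by (simp add: last_conv_nth hd_conv_nth)
    then show False using len xs(1,2) nth_eq_iff_index_eq[of xs "length xs - 1" 0] by simp
  qed
  ultimately have succ: "successively ?A ?ys"
    using xs arcs hd_in_set[OF xs(1)] last_in_set[OF xs(1)] by (simp add: successively_append_iff)
  let ?p = "zip ?ys (tl ?ys)"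
  have ys: "?ys \<noteq> []" "hd ?ys = hd xs" "last ?ys = hd xs" using xs(1) by auto
  note walk = pcas_zip_tl[OF ys(1), unfolded ys(2,3)] pawalk_verts_zip_tl[OF ys(1), unfolded
    ys(2,3)] set_zip_tl map_fst_zip_tl
  have "pre_digraph.awalk (with_proj G) (hd xs) ?p (hd xs)"
    using walk(1) walk(3)[OF succ] hd_in_set[OF xs(1)] xs(3)
    by (simp add: pre_digraph.awalk_def cas_with_proj_eq)
  moreover have "distinct (tl (pre_digraph.awalk_verts (with_proj G) (hd xs) ?p))"
    unfolding awalk_verts_with_proj_eq walk(2) using xs(1,2) by (cases xs) auto
  moreover have "?p \<noteq> []" "3 \<le> length ?p"
  proof -
    have lp: "length ?p = length xs" by simp
    then show "3 \<le> length ?p" using len by linarith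
    then show "?p \<noteq> []" by (metis list.size(3) not_numeral_le_zero)
  qed
  moreover have "fst ` set ?p = pverts G"
  proof -
    have "fst ` set ?p = set (map fst ?p)" by (rule list.set_map[symmetric])
    also have "\<dots> = set xs" unfolding map_fst_zip_tl by simp
    finally show ?thesis using xs(3) by simp
  qed
  ultimately show ?thesis
    unfolding hamiltonian_def hamiltonian_cycle_def pre_digraph.cycle_def by blast
qed

lemma has_hamiltonian_path_if_hpath:
  assumes path: "hpath E (pverts G) u v"
    and arcs: "\<And>x y. x \<in> pverts G \<Longrightarrow> y \<in> pverts G \<Longrightarrow> x \<noteq> y \<Longrightarrow> E x y \<Longrightarrow> (x, y) \<in> parcs G"
  shows "has_hamiltonian_path G"
proof -
  obtain xs where xs: "xs \<noteq> []" "distinct xs" "set xs = pverts G" "successively E xs"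
    using path unfolding hpath_def by blast
  have succ: "successively (\<lambda>x y. (x, y) \<in> parcs G) xs"
    using successively_distinct[OF xs(4,2)] by (rule successively_mono) (use arcs xs(3) in auto)
  note walk = pcas_zip_tl[OF xs(1)] pawalk_verts_zip_tl[OF xs(1)] set_zip_tl
  have "pre_digraph.apath (with_proj G) (hd xs) (zip xs (tl xs)) (last xs)"
    using walk(1,2) walk(3)[OF succ] hd_in_set[OF xs(1)] xs(2,3)
    by (simp add: pre_digraph.apath_def pre_digraph.awalk_def cas_with_proj_eq
      awalk_verts_with_proj_eq)
  moreover have "set (pre_digraph.awalk_verts (with_proj G) (hd xs) (zip xs (tl xs))) = pverts G"
    using walk(2) xs(3) by (simp add: awalk_verts_with_proj_eq)
  ultimately show ?thesis unfolding has_hamiltonian_path_def by blast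
qed

text \<open>On a cycle the vertices before and after a would both be b. As vertices do not repeat,
  their positions agree modulo the length, which then divides 2.\<close>

lemma not_hamiltonian_if_pendant:
  assumes a: "a \<in> pverts G" and "\<And>y. (a, y) \<in> parcs G \<Longrightarrow> y = b" and "\<And>y. (y, a) \<in> parcs G \<Longrightarrow> y = b"
  shows "\<not> hamiltonian G"
proof
  assume "hamiltonian G"
  then obtain p u where p: "pcas u p u" "set p \<subseteq> parcs G" "distinct (tl (pawalk_verts u p))"
      "3 \<le> length p" "fst ` set p = pverts G"
    unfolding hamiltonian_def hamiltonian_cycle_def pre_digraph.cycle_def pre_digraph.awalk_def
      cas_with_proj_eq awalk_verts_with_proj_eq by auto
  let ?n = "length p" and ?s = "\<lambda>i. fst (p ! i)"
  have p0: "p \<noteq> []" using p(4) by auto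
  have u: "u = ?s 0" using p(1) p0 by (cases p) auto
  have "distinct (map fst p)"
    using p(3) pawalk_verts_conv[OF p(1)] u p0 by (cases p) auto
  then have inj: "i = j" if "i < ?n" "j < ?n" "?s i = ?s j" for i j
    using that by (simp add: distinct_conv_nth) metis
  have head: "snd (p ! i) = ?s (Suc i mod ?n)" if "i < ?n" for i
    using pcas_nth[OF p(1) that] u that p0 by (cases "Suc i = ?n") auto
  have arc: "(?s i, ?s (Suc i mod ?n)) \<in> parcs G" if "i < ?n" for i
    using head[OF that] p(2) nth_mem[OF that] by (metis prod.collapse subsetD)
  obtain i where i: "i < ?n" "?s i = a" using a p(5)
    by (metis (no_types, lifting) imageE in_set_conv_nth)
  define j where "j = Suc i mod ?n"
  \<comment> \<open>The summand \<open>?n\<close> prevents truncated subtraction at i = 0.\<close>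
  define k where "k = (i + ?n - 1) mod ?n"
  have jk: "j < ?n" "k < ?n" using p0 by (simp_all add: j_def k_def)
  have ki: "Suc k mod ?n = i" 
  proof -
    have "Suc k mod ?n = Suc (i + ?n - 1) mod ?n" by (simp add: k_def mod_Suc_eq)
    also have "Suc (i + ?n - 1) = i + ?n" using p0 by (cases p) simp_all
    finally show ?thesis using i(1) by simp
  qed
  have "?s j = b" using arc[OF i(1)] i(2) assms(2) by (simp add: j_def)
  moreover have "?s k = b" using arc[OF jk(2)] i(2) assms(3) by (simp add: ki)
  ultimately have "j = k" using inj jk by simp
  then have "Suc (Suc i mod ?n) mod ?n = i" using ki by (simp add: j_def)
  then have "(i + 2) mod ?n = i" by (simp add: mod_Suc_eq)
  moreover have "(i + 2) mod ?n = (if i + 2 < ?n then i + 2 else i + 2 - ?n)"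
    using i(1) p(4) by (simp add: le_mod_geq)
  ultimately show False using i(1) p(4) by (simp split: if_splits)
qed

section \<open>The Jacobson graph\<close>

lemma jacobson_graph_simps:
  "pverts (jacobson_graph R) = carrier R - jacobson_radical R"
  "(x, y) \<in> parcs (jacobson_graph R) \<longleftrightarrow>
     x \<in> carrier R - jacobson_radical R \<and> y \<in> carrier R - jacobson_radical R \<and> x \<noteq> y \<and> unit_adj R x
       y"
  by (simp_all add: jacobson_graph_def unit_adj_def)

text \<open>For x in M but not in M', the elements 1, x and 1 - x are distinct and none lies in all
  maximal ideals. This meets the length bound of \<open>hamiltonian_cycle\<close>.\<close>

lemma (in finite_cring) card_jacobson_vertices:
  assumes "\<not> local_ring R"
  shows "3 \<le> card (carrier R - jacobson_radical R)"
proof -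
  obtain M M' x where M: "maximalideal M R" "maximalideal M' R"
    and x: "x \<in> M" "x \<notin> M'" "x \<in> carrier R"
    using ex_two_maximal[OF assms] by blast
  interpret M: maximalideal M R by fact
  interpret M': maximalideal M' R by fact
  have "(\<one> \<ominus> x) \<oplus> x = \<one>" using x(3) by algebra
  then have nM: "\<one> \<ominus> x \<notin> M" using M.a_closed[of "\<one> \<ominus> x" x] x(1) maximalideal_one[OF M(1)] by auto
  have "x \<noteq> \<zero>" using x(2) M'.zero_closed by auto
  moreover have "\<one> \<ominus> (\<one> \<ominus> x) = x" using x(3) by algebra
  ultimately have "\<one> \<ominus> x \<noteq> \<one>" by (auto simp: minus_eq r_neg)
  moreover have "x \<noteq> \<one>" "\<one> \<ominus> x \<noteq> x" using x(1) nM maximalideal_one[OF M(1)] by auto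
  ultimately have "card {\<one>, x, \<one> \<ominus> x} = 3" by simp
  moreover have "{\<one>, x, \<one> \<ominus> x} \<subseteq> carrier R - jacobson_radical R"
    using x nM M maximalideal_one[OF M(1)] unfolding jacobson_radical_eq by auto
  moreover have "finite (carrier R - jacobson_radical R)" using finite_carrier by simp
  ultimately show ?thesis by (metis card_mono)
qed

theorem theorem2p1:
  fixes R :: "('a, 'm) ring_scheme" (structure)
  assumes "cring R" and "\<one> \<noteq> \<zero>" and "finite (carrier R)" and "\<not> local_ring R"
  shows "((\<nexists>F :: 'a ring. Z2_plus_finite_field R F) \<longrightarrow> hamiltonian (jacobson_graph R)) \<and>
         (\<forall>F :: 'b ring. Z2_plus_finite_field R F \<longrightarrow>
            \<not> hamiltonian (jacobson_graph R) \<and> has_hamiltonian_path (jacobson_graph R))"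
proof (intro conjI impI allI)
  interpret cring R by fact
  interpret finite_cring R by unfold_locales (fact assms)+
  let ?G = "jacobson_graph R"
  {
    assume "\<nexists>F :: 'a ring. Z2_plus_finite_field R F"
    then have "\<nexists>e. finite_reduced_ring.Z2_field_idem R e" if "finite_reduced_ring R"
      using finite_reduced_ring.Z2_plus_corner_ring[OF that] by blast
    then have "hcycle (unit_adj R) (pverts ?G)"
      unfolding jacobson_graph_simps by (intro hcycle_unit_adj assms(4))
    then show "hamiltonian ?G"
      by (rule hamiltonian_if_hcycle)
         (simp_all add: jacobson_graph_simps card_jacobson_vertices[OF assms(4)])
  }
  fix F :: "'b ring"
  assume F: "Z2_plus_finite_field R F"
  interpret S: finite_reduced_ring R by (rule Z2_plus_imp_finite_reduced[OF F])
  obtain e where e: "S.Z2_field_idem e" using Z2_plus_imp_finite_reduced(2)[OF F] by blast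
  obtain v w where "hpath (unit_adj R) (pverts ?G) v w"
    unfolding jacobson_graph_simps using S.hpath_unit_adj[OF e] by blast
  then show "has_hamiltonian_path ?G"
    by (rule has_hamiltonian_path_if_hpath) (simp add: jacobson_graph_simps)
  \<comment> \<open>In coordinates this is (0, 1), the pendant vertex.\<close>
  let ?f = "\<one> \<ominus> e"
  have f: "?f \<in> carrier R" "?f \<noteq> \<zero>"
    using e by (auto simp: S.Z2_field_idem_def S.primitive_def S.idem_def)
  show "\<not> hamiltonian ?G"
  proof (rule not_hamiltonian_if_pendant)
    show "?f \<in> pverts ?G" using f by (simp add: jacobson_graph_simps S.jacobson_radical_eq_zero)
    fix y
    show "y = \<one>" if "(?f, y) \<in> parcs ?G"
      using that S.Z2_field_neighbours[OF e, of y] by (auto simp: jacobson_graph_simps unit_adj_def)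
    show "y = \<one>" if "(y, ?f) \<in> parcs ?G"
      using that S.Z2_field_neighbours[OF e, of y] f m_comm[of y ?f]
      by (auto simp: jacobson_graph_simps unit_adj_def)
  qed
qed

end
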